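(* Let $n\ge 3$, $1\le r<q\le n$, let $\mathcal{H}$ be a Hilbert space and let $T\in\mathfrak{B}^n_{r,q}(\mathcal{H})$. Then \[ \|p(T)\|_{\mathcal{B}(\mathcal{H})}\le\sup_{\bm{z}\in\mathbb{D}^n}|p(\bm{z})| \] for all $p\in\mathbb{C}[z_1,\ldots,z_n]$.
   Context: Hilbert spaces are complex; $\mathbb{D}^n$ is the open unit polydisc in $\mathbb{C}^n$. $\mathcal{T}^m(\mathcal{H})$ is the set of $m$-tuples of commuting contractions in $\mathcal{B}(\mathcal{H})$. For $F=\{n_1,\ldots,n_k\}\subset\{1,\ldots,m\}$ and $T\in\mathcal{T}^m(\mathcal{H})$, $T_F=T_{n_1}\cdots T_{n_k}$, with $T_\emptyset=I_{\mathcal{H}}$. $T\in\mathcal{T}^m(\mathcal{H})$ satisfies Brehmer positivity if $\sum_{F\subset G}(-1)^{|F|}T_FT_F^*\ge 0$ for all $G\subset\{1,\ldots,m\}$; $\mathfrak{B}^m(\mathcal{H})$ denotes the set of all such $T$. For an $n$-tuple $T$, $\hat{T}_i$ denotes the $(n-1)$-tuple obtained by deleting $T_i$. For $1\le r<q\le n$, $\mathfrak{B}^n_{r,q}(\mathcal{H})=\{T\in\mathcal{T}^n(\mathcal{H}):\hat{T}_r,\hat{T}_q\in\mathfrak{B}^{n-1}(\mathcal{H})\}$. *)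

theory Defs
  imports "HOL-Analysis.Analysis" "HOL-Library.Poly_Mapping"
begin

section \<open>Complex Hilbert spaces\<close>

text \<open>
  A complex inner product space is presented over its underlying real inner product space: the real
  inner product is the real part of the complex one, so that norm, metric and topology are the ones
  of \<^class>\<open>real_inner\<close>. The complex inner product is linear in the first argument.
\<close>

class complex_inner = real_inner +
  fixes scaleC :: "complex \<Rightarrow> 'a \<Rightarrow> 'a"  (infixr \<open>*\<^sub>C\<close> 75)
    and cinner :: "'a \<Rightarrow> 'a \<Rightarrow> complex"
  assumes scaleC_add_right: "c *\<^sub>C (x + y) = c *\<^sub>C x + c *\<^sub>C y"
    and scaleC_add_left: "(c + d) *\<^sub>C x = c *\<^sub>C x + d *\<^sub>C x"
    and scaleC_scaleC: "c *\<^sub>C d *\<^sub>C x = (c * d) *\<^sub>C x"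
    and scaleC_of_real: "complex_of_real r *\<^sub>C x = r *\<^sub>R x"
    and cinner_commute: "cinner x y = cnj (cinner y x)"
    and cinner_add_left: "cinner (x + y) z = cinner x z + cinner y z"
    and cinner_scaleC_left: "cinner (c *\<^sub>C x) y = c * cinner x y"
    and Re_cinner: "Re (cinner x y) = inner x y"

class chilbert_space = complex_inner + complete_space

lemma cinner_self: "cinner x x = complex_of_real ((norm x)\<^sup>2)"
  for x :: "'a::complex_inner"
proof -
  have "Im (cinner x x) = 0"
    using arg_cong[OF cinner_commute[of x x], of Im] by simp
  then show ?thesis
    by (simp add: complex_eq_iff Re_cinner power2_norm_eq_inner)
qed

instantiation complex :: chilbert_space
begin

definition scaleC_complex :: "complex \<Rightarrow> complex \<Rightarrow> complex"
  where "scaleC_complex c x = c * x"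

definition cinner_complex :: "complex \<Rightarrow> complex \<Rightarrow> complex"
  where "cinner_complex x y = x * cnj y"

instance
  by standard
    (auto simp: scaleC_complex_def cinner_complex_def scaleR_conv_of_real inner_complex_def
      algebra_simps)

end


section \<open>Bounded operators and adjoints\<close>

definition bounded_clinear :: "('a::complex_inner \<Rightarrow> 'b::complex_inner) \<Rightarrow> bool"
  where "bounded_clinear A \<longleftrightarrow> bounded_linear A \<and> (\<forall>c x. A (c *\<^sub>C x) = c *\<^sub>C A x)"

definition cadjoint :: "('a::chilbert_space \<Rightarrow> 'a) \<Rightarrow> 'a \<Rightarrow> 'a"
  where "cadjoint A = (THE B. \<forall>x y. cinner (A x) y = cinner x (B y))"

definition positive_op :: "('a::chilbert_space \<Rightarrow> 'a) \<Rightarrow> bool"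
  where "positive_op A \<longleftrightarrow> bounded_clinear A \<and> (\<forall>x. cinner (A x) x \<in> \<real>\<^sub>\<ge>\<^sub>0)"

text \<open>The description in \<^const>\<open>cadjoint\<close> is proper for every bounded operator.\<close>

lemma riesz_real:
  fixes f :: "'a::{real_inner, complete_space} \<Rightarrow> real"
  assumes f: "bounded_linear f"
  shows "\<exists>v. \<forall>x. f x = inner v x"
proof -
  interpret f: bounded_linear f by fact
  obtain K where K: "\<And>x. norm (f x) \<le> norm x * K" "K \<ge> 0"
    using f.nonneg_bounded by blast
  define J where "J x = (norm x)\<^sup>2 - 2 * f x" for x
  have J_lower: "J x \<ge> - K\<^sup>2" for x
  proof -
    have "f x \<le> norm x * K" using K(1)[of x] by auto
    moreover have "(norm x - K)\<^sup>2 \<ge> 0" by simp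
    ultimately show ?thesis
      unfolding J_def by (simp add: power2_diff)
  qed
  define m where "m = (INF x. J x)"
  have bdd: "bdd_below (range J)"
    using J_lower by (auto intro!: bdd_belowI)
  have mJ: "m \<le> J x" for x
    unfolding m_def by (rule cINF_lower[OF bdd]) simp
  have "\<exists>x. J x < m + 1 / real (Suc n)" for n
  proof (rule ccontr)
    assume "\<nexists>x. J x < m + 1 / real (Suc n)"
    then have "m + 1 / real (Suc n) \<le> (INF x. J x)"
      by (intro cINF_greatest) (auto simp: not_less)
    then show False unfolding m_def by (auto simp: field_simps)
  qed
  then obtain X where X: "\<And>n. J (X n) < m + 1 / real (Suc n)" by metis
  have par: "(norm (x - y))\<^sup>2 = 2 * (J x + J y - 2 * J ((1/2) *\<^sub>R (x + y)))" for x y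
    unfolding J_def f.scaleR f.add power2_norm_eq_inner
    by (simp add: inner_add_left inner_add_right inner_diff_left inner_diff_right inner_commute
        algebra_simps)
  have close: "(norm (X i - X j))\<^sup>2 \<le> 2 * (1 / real (Suc i) + 1 / real (Suc j))" for i j
  proof -
    have "J (X i) + J (X j) - 2 * J ((1/2) *\<^sub>R (X i + X j))
        \<le> (m + 1 / real (Suc i)) + (m + 1 / real (Suc j)) - 2 * m"
      by (intro diff_mono add_mono mult_left_mono less_imp_le X mJ) simp
    then show ?thesis unfolding par by simp
  qed
  have "Cauchy X"
  proof (rule metric_CauchyI)
    fix e :: real assume e: "e > 0"
    then obtain N where N: "1 / real (Suc N) < e\<^sup>2 / 4"
      using reals_Archimedean[of "e\<^sup>2 / 4"] by (auto simp: inverse_eq_divide)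
    have "dist (X i) (X j) < e" if "i \<ge> N" "j \<ge> N" for i j
    proof -
      have "1 / real (Suc i) \<le> 1 / real (Suc N)" "1 / real (Suc j) \<le> 1 / real (Suc N)"
        using that by (auto simp: frac_le)
      then have "2 * (1 / real (Suc i) + 1 / real (Suc j)) \<le> 2 * (1 / real (Suc N) + 1 / real (Suc N))"
        by (intro mult_left_mono add_mono) auto
      also have "\<dots> < e\<^sup>2"
        using N by simp
      finally have "(norm (X i - X j))\<^sup>2 < e\<^sup>2"
        using close[of i j] by (rule le_less_trans[rotated])
      then show ?thesis
        using e by (simp add: dist_norm power_less_imp_less_base)
    qed
    then show "\<exists>N. \<forall>i\<ge>N. \<forall>j\<ge>N. dist (X i) (X j) < e" by blast
  qed
  then obtain v where v: "X \<longlonglongrightarrow> v"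
    using Cauchy_convergent convergent_def by blast
  have "(\<lambda>n. J (X n)) \<longlonglongrightarrow> J v"
    unfolding J_def by (intro tendsto_intros v f.tendsto)
  moreover have "(\<lambda>n. m + 1 / real (Suc n)) \<longlonglongrightarrow> m + 0"
    by (intro tendsto_intros LIMSEQ_Suc lim_const_over_n)
  ultimately have "J v \<le> m + 0"
    by (rule LIMSEQ_le) (intro exI allI impI less_imp_le X)
  then have Jv: "J v \<le> m" by simp
  have "f h = inner v h" for h
  proof (rule ccontr)
    assume "f h \<noteq> inner v h"
    define d where "d = inner v h - f h"
    have d: "d \<noteq> 0" using \<open>f h \<noteq> inner v h\<close> by (simp add: d_def)
    have h: "h \<noteq> 0" using \<open>f h \<noteq> inner v h\<close> by (auto simp: f.zero)
    have nh: "inner h h > 0" using h by simp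
    have "J (v + t *\<^sub>R h) = J v + 2 * t * d + t\<^sup>2 * inner h h" for t
      unfolding J_def d_def f.add f.scaleR power2_norm_eq_inner
      by (simp add: inner_add_left inner_add_right inner_commute algebra_simps power2_eq_square)
    then have ge: "2 * t * d + t\<^sup>2 * inner h h \<ge> 0" for t
      using order_trans[OF Jv mJ[of "v + t *\<^sub>R h"]] by simp
    have "2 * (- d / inner h h) * d + (- d / inner h h)\<^sup>2 * inner h h = - (d\<^sup>2 / inner h h)"
      using nh by (simp add: power2_eq_square field_simps)
    with ge[of "- d / inner h h"] have "d\<^sup>2 / inner h h \<le> 0" by linarith
    moreover have "d\<^sup>2 / inner h h > 0" using d nh by simp
    ultimately show False by linarith
  qed
  then show ?thesis by blast
qed

lemma cinner_right_unique:
  fixes y z :: "'a::complex_inner"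
  assumes "\<And>x. cinner x y = cinner x z"
  shows "y = z"
proof -
  have "inner x (y - z) = 0" for x
    using arg_cong[OF assms[of x], of Re] by (simp add: Re_cinner inner_diff_right)
  then have "inner (y - z) (y - z) = 0" .
  then show ?thesis by simp
qed

lemma cadjoint:
  fixes A :: "'a::chilbert_space \<Rightarrow> 'a"
  assumes A: "bounded_clinear A"
  shows "cinner (A x) y = cinner x (cadjoint A y)"
proof -
  have bl: "bounded_linear A" and hom: "\<And>c x. A (c *\<^sub>C x) = c *\<^sub>C A x"
    using A by (auto simp: bounded_clinear_def)
  have "\<exists>v. \<forall>x. inner (A x) y = inner v x" for y
    by (rule riesz_real)
      (rule bounded_linear_compose[OF bounded_linear_inner_left bl])
  then obtain B where B: "\<And>x y. inner (A x) y = inner (B y) x" by metis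
  have re: "Re (cinner (A x) y) = Re (cinner x (B y))" for x y
    unfolding Re_cinner by (metis B inner_commute)
  have im: "Im (cinner (A x) y) = Im (cinner x (B y))" for x y
    using re[of "\<i> *\<^sub>C x" y] by (simp add: hom cinner_scaleC_left)
  have *: "\<forall>x y. cinner (A x) y = cinner x (B y)"
    using re im by (simp add: complex_eq_iff)
  have "\<forall>x y. cinner (A x) y = cinner x (cadjoint A y)"
    unfolding cadjoint_def
  proof (rule theI[of _ B])
    show "\<forall>x y. cinner (A x) y = cinner x (B y)" by fact
    fix C assume C: "\<forall>x y. cinner (A x) y = cinner x (C y)"
    show "C = B"
      by (rule ext, rule cinner_right_unique) (simp flip: *[rule_format] C[rule_format])
  qed
  then show ?thesis by blast
qed


section \<open>Tuples of commuting contractions and Brehmer positivity\<close>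

text \<open>
  An \<open>m\<close>-tuple is a function on \<^typ>\<open>nat\<close> of which only the values at the indices \<open>1, \<dots>, m\<close> matter.
\<close>

definition commuting_contractions :: "nat \<Rightarrow> (nat \<Rightarrow> 'a::chilbert_space \<Rightarrow> 'a) set"
  where "commuting_contractions m = {T.
    (\<forall>i\<in>{1..m}. bounded_clinear (T i) \<and> onorm (T i) \<le> 1) \<and>
    (\<forall>i\<in>{1..m}. \<forall>j\<in>{1..m}. T i \<circ> T j = T j \<circ> T i)}"

text \<open>The product over a finite index set, taken in increasing order of the indices.\<close>

definition ordered_comp :: "(nat \<Rightarrow> 'a \<Rightarrow> 'a) \<Rightarrow> nat set \<Rightarrow> 'a \<Rightarrow> 'a"
  where "ordered_comp T F = foldr (\<circ>) (map T (sorted_list_of_set F)) id"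

definition brehmer :: "nat \<Rightarrow> (nat \<Rightarrow> 'a::chilbert_space \<Rightarrow> 'a) set"
  where "brehmer m = {T \<in> commuting_contractions m.
    \<forall>G\<subseteq>{1..m}. positive_op
      (\<lambda>x. \<Sum>F\<in>Pow G. (-1) ^ card F *\<^sub>R ordered_comp T F (cadjoint (ordered_comp T F) x))}"

definition delete_entry :: "nat \<Rightarrow> (nat \<Rightarrow> 'b) \<Rightarrow> nat \<Rightarrow> 'b"
  where "delete_entry i T = (\<lambda>j. if j < i then T j else T (Suc j))"

definition brehmer_rq :: "nat \<Rightarrow> nat \<Rightarrow> nat \<Rightarrow> (nat \<Rightarrow> 'a::chilbert_space \<Rightarrow> 'a) set"
  where "brehmer_rq n r q = {T \<in> commuting_contractions n.
    delete_entry r T \<in> brehmer (n - 1) \<and> delete_entry q T \<in> brehmer (n - 1)}"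


section \<open>Polynomials\<close>

text \<open>
  A polynomial maps each exponent vector, itself a finitely supported function from variable indices
  to exponents, to its coefficient.
\<close>

type_synonym cpoly = "(nat \<Rightarrow>\<^sub>0 nat) \<Rightarrow>\<^sub>0 complex"

definition polys :: "nat \<Rightarrow> cpoly set"
  where "polys n = {p. \<forall>\<alpha>\<in>Poly_Mapping.keys p. Poly_Mapping.keys \<alpha> \<subseteq> {1..n}}"

definition poly_eval :: "cpoly \<Rightarrow> (nat \<Rightarrow> complex) \<Rightarrow> complex"
  where "poly_eval p z = (\<Sum>\<alpha>\<in>Poly_Mapping.keys p.
    Poly_Mapping.lookup p \<alpha> * (\<Prod>i\<in>Poly_Mapping.keys \<alpha>. z i ^ Poly_Mapping.lookup \<alpha> i))"

definition poly_op :: "cpoly \<Rightarrow> (nat \<Rightarrow> 'a::chilbert_space \<Rightarrow> 'a) \<Rightarrow> 'a \<Rightarrow> 'a"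
  where "poly_op p T = (\<lambda>x. \<Sum>\<alpha>\<in>Poly_Mapping.keys p.
    Poly_Mapping.lookup p \<alpha> *\<^sub>C
      ordered_comp (\<lambda>i. T i ^^ Poly_Mapping.lookup \<alpha> i) (Poly_Mapping.keys \<alpha>) x)"

definition polydisc :: "nat \<Rightarrow> (nat \<Rightarrow> complex) set"
  where "polydisc n = {1..n} \<rightarrow>\<^sub>E ball 0 1"

text \<open>The supremum of a polynomial over the polydisc is one of a nonempty bounded set of reals.\<close>

lemma polydisc_nonempty: "polydisc n \<noteq> {}"
  by (simp add: polydisc_def PiE_eq_empty_iff)

lemma bdd_above_poly_eval:
  assumes "p \<in> polys n"
  shows "bdd_above ((\<lambda>z. cmod (poly_eval p z)) ` polydisc n)"
proof (rule bdd_aboveI2)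
  fix z assume z: "z \<in> polydisc n"
  have le: "cmod (z i) \<le> 1" if "\<alpha> \<in> Poly_Mapping.keys p" "i \<in> Poly_Mapping.keys \<alpha>" for \<alpha> i
  proof -
    have "i \<in> {1..n}" using that assms unfolding polys_def by blast
    with z have "z i \<in> ball 0 1" unfolding polydisc_def by (rule PiE_mem)
    then show ?thesis by simp
  qed
  have "cmod (poly_eval p z) \<le> (\<Sum>\<alpha>\<in>Poly_Mapping.keys p.
      cmod (Poly_Mapping.lookup p \<alpha>) *
        (\<Prod>i\<in>Poly_Mapping.keys \<alpha>. cmod (z i) ^ Poly_Mapping.lookup \<alpha> i))"
    unfolding poly_eval_def
    by (rule order_trans[OF norm_sum]) (simp add: norm_mult norm_power flip: prod_norm)
  also have "\<dots> \<le> (\<Sum>\<alpha>\<in>Poly_Mapping.keys p. cmod (Poly_Mapping.lookup p \<alpha>))"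
    by (intro sum_mono mult_left_le prod_le_1) (auto intro!: power_le_one le)
  finally show "cmod (poly_eval p z) \<le>
    (\<Sum>\<alpha>\<in>Poly_Mapping.keys p. cmod (Poly_Mapping.lookup p \<alpha>))" .
qed

end

theory Submission
  imports Defs
begin

text \<open>
  Fix \<open>0 < s < 1\<close> and let \<open>X\<^sub>i = s T\<^sub>i*\<close>. It is enough to estimate polynomials in the \<open>X\<^sub>i\<close>, since \<open>s\<close> can
  then tend to \<open>1\<close> and an operator has the norm of its adjoint. The Brehmer sum over the subsets of \<open>G\<close>
  defines a Hermitian form \<open>Q\<^sub>G(x, y) = (\<Sum>F \<subseteq> G. (-1) ^ card F <X\<^sub>F x, X\<^sub>F y>)\<close>. If \<open>G\<close> omits \<open>r\<close> or \<open>q\<close>,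
  the hypothesis applies, and scaling makes the form coercive (\<open>coercive_brehmer_form\<close>), that is, an
  equivalent inner product. Moreover the form of \<open>G \<union> {j}\<close> is the defect form of \<open>X\<^sub>j\<close> with respect to \<open>Q\<^sub>G\<close>,
  namely \<open>Q\<^sub>G(x, y) - Q\<^sub>G(X\<^sub>j x, X\<^sub>j y)\<close> (\<open>brehmer_form_insert\<close>).

  The variables are removed one at a time. Suppose that the defect form \<open>Q'\<close> of \<open>X\<close> with respect to \<open>Q\<close> is
  coercive, and let \<open>R z = (1 - cnj z X)\<^sup>-\<^sup>1\<close> for \<open>\<bar>z\<bar> = 1\<close>. Then \<open>h \<mapsto> R z h\<close> embeds the space with the
  form \<open>Q\<close> isometrically into the square-integrable functions on the circle, fibres being normed by \<open>Q'\<close>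
  (\<open>mean_defect_resolvent\<close>), and \<open>R z (X h)\<close> differs from \<open>z R z h\<close> by a function with positive
  frequencies only, which is orthogonal to the image. So \<open>X\<close> may be treated as the scalar \<open>z\<close>, and an
  inequality for \<open>Q'\<close> on each fibre yields the same one for \<open>Q\<close> (\<open>transference\<close>). In particular, if the
  von Neumann inequality holds for the form \<open>Q'\<close> and a commuting tuple, then it holds for \<open>Q\<close> and the tuple
  with \<open>X\<close> added (\<open>von_neumann_insert\<close>).

  Let \<open>S\<close> be the set of indices other than \<open>r\<close> and \<open>q\<close>. The reduction leads to the form \<open>Q\<^sub>S\<close> and the pair
  \<open>X\<^sub>r, X\<^sub>q\<close>. Each of the two operators has a coercive defect, but the form of \<open>S \<union> {r, q}\<close> need not be
  positive. The reduction stops here, and an argument in the spirit of Ando's theorem takes over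
  (\<open>von_neumann_pair\<close>). Passing to the circle by means of \<open>X\<^sub>r\<close> turns \<open>X\<^sub>q\<close> into the values on the circle
  of a transfer function that is contractive for the defect form of \<open>X\<^sub>r\<close>. On each fibre a polynomial in
  the pair is thus a polynomial in one contraction, and for one contraction the inequality follows by
  removing the last variable.
\<close>

section \<open>Complex inner product spaces\<close>

lemma scaleC_zero_left [simp]: "0 *\<^sub>C (x::'a::complex_inner) = 0"
  using scaleC_of_real[of 0 x] by simp

lemma scaleC_one [simp]: "1 *\<^sub>C (x::'a::complex_inner) = x"
  using scaleC_of_real[of 1 x] by simp

lemma scaleC_minus_left: "(- c) *\<^sub>C (x::'a::complex_inner) = - (c *\<^sub>C x)"
  using scaleC_add_left[of c "-c" x] by (simp add: eq_neg_iff_add_eq_0 add.commute)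

lemma scaleC_zero_right [simp]: "c *\<^sub>C (0::'a::complex_inner) = 0"
  using scaleC_add_right[of c 0 "0::'a"] by simp

lemma scaleC_minus_right: "c *\<^sub>C (- x) = - (c *\<^sub>C (x::'a::complex_inner))"
  using scaleC_add_right[of c x "-x"] by (simp add: eq_neg_iff_add_eq_0 add.commute)

lemma scaleC_diff_right: "c *\<^sub>C (x - y) = c *\<^sub>C x - c *\<^sub>C (y::'a::complex_inner)"
  using scaleC_add_right[of c x "-y"] by (simp add: scaleC_minus_right)

lemma scaleC_sum_right: "c *\<^sub>C (\<Sum>i\<in>I. f i) = (\<Sum>i\<in>I. c *\<^sub>C (f i::'a::complex_inner))"
  by (induction I rule: infinite_finite_induct) (simp_all add: scaleC_add_right)

lemma scaleC_sum_left: "(\<Sum>i\<in>I. f i) *\<^sub>C (x::'a::complex_inner) = (\<Sum>i\<in>I. f i *\<^sub>C x)"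
  by (induction I rule: infinite_finite_induct) (simp_all add: scaleC_add_left)

lemma cinner_add_right: "cinner x (y + z) = cinner x y + cinner x (z::'a::complex_inner)"
  using cinner_commute[of x "y + z"] cinner_commute[of x y] cinner_commute[of x z]
  by (simp add: cinner_add_left)

lemma cinner_scaleC_right: "cinner x (c *\<^sub>C y) = cnj c * cinner x (y::'a::complex_inner)"
  using cinner_commute[of x "c *\<^sub>C y"] cinner_commute[of x y]
  by (simp add: cinner_scaleC_left)

lemma norm_scaleC: "norm (c *\<^sub>C (x::'a::complex_inner)) = cmod c * norm x"
proof -
  have "complex_of_real ((norm (c *\<^sub>C x))\<^sup>2) = complex_of_real ((cmod c * norm x)\<^sup>2)"
    using cinner_self[of "c *\<^sub>C x"] cinner_self[of x] complex_norm_square[of c]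
    by (simp add: cinner_scaleC_left cinner_scaleC_right power_mult_distrib mult_ac)
  then have "(norm (c *\<^sub>C x))\<^sup>2 = (cmod c * norm x)\<^sup>2"
    using of_real_eq_iff by blast
  then show ?thesis by simp
qed

text \<open>Rotating \<open>x\<close> so that the inner product becomes real reduces this to the real inequality.\<close>

lemma norm_cinner_le: "cmod (cinner x y) \<le> norm x * norm (y::'a::complex_inner)"
proof (cases "cinner x y = 0")
  case False
  define c where "c = cnj (cinner x y) / cmod (cinner x y)"
  have c: "cmod c = 1" using False by (simp add: c_def norm_divide)
  have "c * cinner x y = complex_of_real (cmod (cinner x y))"
    using False complex_norm_square[of "cinner x y"]
    by (simp add: c_def field_simps power2_eq_square)
  then have "Re (cinner (c *\<^sub>C x) y) = cmod (cinner x y)"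
    by (simp add: cinner_scaleC_left)
  then show ?thesis
    using norm_cauchy_schwarz[of "c *\<^sub>C x" y] c by (simp add: Re_cinner norm_scaleC)
qed simp

section \<open>Bounded complex-linear maps\<close>

lemma bounded_clinearI:
  assumes "\<And>x y. A (x + y) = A x + A y" "\<And>c x. A (c *\<^sub>C x) = c *\<^sub>C A x"
    "\<And>x. norm (A x) \<le> norm x * K"
  shows "bounded_clinear A"
proof -
  have "bounded_linear A"
  proof (rule bounded_linear_intro)
    show "A (x + y) = A x + A y" for x y by (rule assms)
    show "A (r *\<^sub>R x) = r *\<^sub>R A x" for r x
      using assms(2)[of "complex_of_real r" x] by (simp add: scaleC_of_real)
    show "norm (A x) \<le> norm x * K" for x by (rule assms)
  qed
  then show ?thesis using assms(2) by (simp add: bounded_clinear_def)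
qed

lemma bounded_clinearD:
  assumes "bounded_clinear A"
  shows "A (x + y) = A x + A y" "A (c *\<^sub>C x) = c *\<^sub>C A x" "A (x - y) = A x - A y" "A 0 = 0"
    "A (\<Sum>i\<in>I. f i) = (\<Sum>i\<in>I. A (f i))" "A (s *\<^sub>R x) = s *\<^sub>R A x"
proof -
  interpret bounded_linear A using assms by (simp add: bounded_clinear_def)
  show "A (x + y) = A x + A y" "A (x - y) = A x - A y" "A 0 = 0"
    "A (\<Sum>i\<in>I. f i) = (\<Sum>i\<in>I. A (f i))" "A (s *\<^sub>R x) = s *\<^sub>R A x"
    by (rule add diff zero sum scaleR)+
  show "A (c *\<^sub>C x) = c *\<^sub>C A x" using assms by (simp add: bounded_clinear_def)
qed

lemma bounded_clinear_bound:
  assumes "bounded_clinear A"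
  obtains K where "K > 0" "\<And>x. norm (A x) \<le> K * norm x"
proof -
  interpret bounded_linear A using assms by (simp add: bounded_clinear_def)
  show ?thesis using pos_bounded that by (metis mult.commute)
qed

lemma bounded_clinear_compose:
  assumes "bounded_clinear A" "bounded_clinear B"
  shows "bounded_clinear (\<lambda>x. A (B x))"
  using assms bounded_linear_compose[of A B] by (auto simp: bounded_clinear_def)

lemma bounded_clinear_id: "bounded_clinear (\<lambda>x. x)"
  by (simp add: bounded_clinear_def bounded_linear_ident)

lemma bounded_clinear_funpow: "bounded_clinear (A :: 'a::complex_inner \<Rightarrow> 'a) \<Longrightarrow> bounded_clinear (A ^^ n)"
proof (induction n)
  case 0
  have "A ^^ 0 = (\<lambda>x. x)" by (simp add: fun_eq_iff)
  then show ?case using bounded_clinear_id by metis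
next
  case (Suc n)
  then show ?case using bounded_clinear_compose[of A "A ^^ n"] by (simp add: o_def)
qed

lemma bounded_clinear_diff:
  assumes "bounded_clinear A" "bounded_clinear B"
  shows "bounded_clinear (\<lambda>x. A x - B x)"
  using assms bounded_linear_sub[of A B] by (simp add: bounded_clinear_def scaleC_diff_right)

lemma bounded_clinear_scaleC:
  assumes "bounded_clinear A"
  shows "bounded_clinear (\<lambda>x. c *\<^sub>C A x)"
proof -
  obtain K where K: "\<And>x. norm (A x) \<le> K * norm x" using bounded_clinear_bound[OF assms] by blast
  show ?thesis
  proof (rule bounded_clinearI[where K = "cmod c * K"])
    fix x
    show "norm (c *\<^sub>C A x) \<le> norm x * (cmod c * K)"
      using mult_left_mono[OF K, of "cmod c" x] by (simp add: norm_scaleC mult_ac)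
  qed (simp_all add: bounded_clinearD[OF assms] scaleC_add_right scaleC_scaleC mult.commute)
qed

section \<open>Coercive forms and the Lax-Milgram theorem\<close>

text \<open>
  The Hilbert space is fixed once and for all by the type, while the argument renorms it repeatedly.
  Each new inner product is therefore a form on the same space, and a bounded coercive form is an
  equivalent inner product.
\<close>

locale bounded_sesquilinear =
  fixes b :: "'a::complex_inner \<Rightarrow> 'a \<Rightarrow> complex"
  assumes add_left: "b (x + y) z = b x z + b y z"
    and add_right: "b x (y + z) = b x y + b x z"
    and scale_left: "b (c *\<^sub>C x) y = c * b x y"
    and scale_right: "b x (c *\<^sub>C y) = cnj c * b x y"
    and bounded: "\<exists>K. \<forall>x y. cmod (b x y) \<le> K * norm x * norm y"
begin

lemma bound:
  obtains K where "K > 0" "\<And>x y. cmod (b x y) \<le> K * norm x * norm y"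
proof -
  obtain K where K: "\<And>x y. cmod (b x y) \<le> K * norm x * norm y" using bounded by blast
  have "cmod (b x y) \<le> max K 1 * norm x * norm y" for x y
    by (rule order_trans[OF K]) (intro mult_right_mono; simp)
  then show ?thesis using that[of "max K 1"] by simp
qed

lemma minus_left: "b (- x) y = - b x y"
  using scale_left[of "-1" x y] by (simp add: scaleC_minus_left)

lemma minus_right: "b x (- y) = - b x y"
  using scale_right[of x "-1" y] by (simp add: scaleC_minus_left)

lemma zero_left: "b 0 y = 0"
  using scale_left[of 0 0 y] by simp

lemma zero_right: "b y 0 = 0"
  using scale_right[of y 0 0] by simp

lemma diff_left: "b (x - y) z = b x z - b y z"
  using add_left[of x "-y" z] by (simp add: minus_left)

lemma diff_right: "b x (y - z) = b x y - b x z"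
  using add_right[of x y "-z"] by (simp add: minus_right)

lemma sum_left: "b (\<Sum>i\<in>I. f i) y = (\<Sum>i\<in>I. b (f i) y)"
  by (induction I rule: infinite_finite_induct) (simp_all add: add_left zero_left)

lemma sum_right: "b y (\<Sum>i\<in>I. f i) = (\<Sum>i\<in>I. b y (f i))"
  by (induction I rule: infinite_finite_induct) (simp_all add: add_right zero_right)

lemmas linear_simps = add_left add_right diff_left diff_right scale_left scale_right

end

locale coercive_form = bounded_sesquilinear +
  assumes hermitian: "b y x = cnj (b x y)"
    and coercive: "\<exists>e>0. \<forall>x. e * (norm x)\<^sup>2 \<le> Re (b x x)"
begin

lemma nonneg: "0 \<le> Re (b x x)"
  using coercive by (metis mult_nonneg_nonneg order_less_imp_le order_trans zero_le_power2)

lemma eq_zeroI: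
  assumes "\<And>k. b x k = 0"
  shows "x = 0"
proof -
  obtain e where "e > 0" "e * (norm x)\<^sup>2 \<le> Re (b x x)" using coercive by blast
  then show ?thesis using assms[of x] by (simp add: mult_le_0_iff)
qed

lemma Re_commute: "Re (b y x) = Re (b x y)"
  using hermitian[of x y] by simp

lemma quadratic_diff: "Re (b (x - y) (x - y)) = Re (b x x) - 2 * Re (b x y) + Re (b y y)"
  using Re_commute[of x y] by (simp add: diff_left diff_right)

lemma two_Re_le: "2 * Re (b x y) \<le> Re (b x x) + Re (b y y)"
  using nonneg[of "x - y"] unfolding quadratic_diff by linarith

lemma quadratic_scale: "Re (b (c *\<^sub>C x) (c *\<^sub>C x)) = (cmod c)\<^sup>2 * Re (b x x)"
  by (simp add: scale_left scale_right mult.assoc[symmetric] power2_eq_square cmod_power2[unfolded power2_eq_square])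

end

lemma sesquilinear_cinner: "bounded_sesquilinear (cinner :: 'a::complex_inner \<Rightarrow> _)"
proof
  show "\<exists>K. \<forall>x y::'a. cmod (cinner x y) \<le> K * norm x * norm y"
    by (rule exI[of _ 1]) (simp add: norm_cinner_le)
qed (simp_all add: cinner_add_left cinner_add_right cinner_scaleC_left cinner_scaleC_right)

lemma bounded_sesquilinear_compose:
  assumes "bounded_sesquilinear b" "bounded_clinear A" "bounded_clinear B"
  shows "bounded_sesquilinear (\<lambda>x y. b (A x) (B y))"
proof -
  interpret bounded_sesquilinear b by fact
  obtain K where K: "K > 0" "\<And>x y. cmod (b x y) \<le> K * norm x * norm y" using bound by blast
  obtain L where L: "L > 0" "\<And>x. norm (A x) \<le> L * norm x"
    using bounded_clinear_bound[OF assms(2)] by blast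
  obtain M where M: "M > 0" "\<And>x. norm (B x) \<le> M * norm x"
    using bounded_clinear_bound[OF assms(3)] by blast
  show ?thesis
  proof
    have "cmod (b (A x) (B y)) \<le> (K * L * M) * norm x * norm y" for x y
    proof -
      have "cmod (b (A x) (B y)) \<le> K * norm (A x) * norm (B y)" by (rule K)
      also have "\<dots> \<le> K * (L * norm x) * (M * norm y)"
        using K(1) L M by (intro mult_mono) (auto intro: less_imp_le mult_nonneg_nonneg)
      finally show ?thesis by (simp add: mult_ac)
    qed
    then show "\<exists>K. \<forall>x y. cmod (b (A x) (B y)) \<le> K * norm x * norm y" by blast
  qed (simp_all add: linear_simps bounded_clinearD[OF assms(2)] bounded_clinearD[OF assms(3)])
qed

lemma bounded_sesquilinear_add:
  assumes "bounded_sesquilinear b" "bounded_sesquilinear c"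
  shows "bounded_sesquilinear (\<lambda>x y. b x y + c x y)"
proof -
  interpret b: bounded_sesquilinear b by fact
  interpret c: bounded_sesquilinear c by fact
  obtain K where K: "K > 0" "\<And>x y. cmod (b x y) \<le> K * norm x * norm y" using b.bound by blast
  obtain L where L: "L > 0" "\<And>x y. cmod (c x y) \<le> L * norm x * norm y" using c.bound by blast
  show ?thesis
  proof
    have "cmod (b x y + c x y) \<le> (K + L) * norm x * norm y" for x y
      using norm_triangle_ineq[of "b x y" "c x y"] K(2)[of x y] L(2)[of x y]
      unfolding distrib_right by linarith
    then show "\<exists>K. \<forall>x y. cmod (b x y + c x y) \<le> K * norm x * norm y" by blast
  qed (simp_all only: b.linear_simps c.linear_simps, simp_all add: distrib_left)
qed

lemma bounded_sesquilinear_diff: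
  assumes "bounded_sesquilinear b" "bounded_sesquilinear c"
  shows "bounded_sesquilinear (\<lambda>x y. b x y - c x y)"
proof -
  have "bounded_clinear (\<lambda>x::'a. - x)"
    using bounded_clinear_scaleC[OF bounded_clinear_id, of "-1"] by (simp add: scaleC_minus_left)
  from bounded_sesquilinear_add[OF assms(1) bounded_sesquilinear_compose[OF assms(2) this bounded_clinear_id]]
  show ?thesis using bounded_sesquilinear.minus_left[OF assms(2)] by simp
qed

text \<open>
  The real Riesz theorem gives the operator; testing with \<open>\<i> y\<close> recovers the imaginary part.
\<close>

lemma bounded_sesquilinear_operator:
  fixes b :: "'a::chilbert_space \<Rightarrow> 'a \<Rightarrow> complex"
  assumes "bounded_sesquilinear b"
  shows "\<exists>B. bounded_clinear B \<and> (\<forall>x y. b x y = cinner (B x) y)"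
proof -
  interpret bounded_sesquilinear b by fact
  interpret c: bounded_sesquilinear "cinner :: 'a \<Rightarrow> _" by (rule sesquilinear_cinner)
  obtain K where K: "K > 0" "\<And>x y. cmod (b x y) \<le> K * norm x * norm y" using bound by blast
  have "\<exists>v. \<forall>y. Re (b x y) = inner v y" for x
  proof (rule riesz_real, rule bounded_linear_intro)
    show "Re (b x (r *\<^sub>R y)) = r *\<^sub>R Re (b x y)" for r y
      using scale_right[of x "complex_of_real r" y] by (simp add: scaleC_of_real)
    show "norm (Re (b x y)) \<le> norm y * (K * norm x)" for y
      using order_trans[OF abs_Re_le_cmod K(2)[of x y]] by (simp add: mult_ac)
  qed (simp add: add_right)
  then obtain B where B: "\<And>x y. Re (b x y) = inner (B x) y" by metis
  have re: "Re (b x y) = Re (cinner (B x) y)" for x y by (simp add: B Re_cinner)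
  have im: "Im (b x y) = Im (cinner (B x) y)" for x y
    using re[of x "\<i> *\<^sub>C y"] by (simp add: scale_right cinner_scaleC_right)
  have eq: "b x y = cinner (B x) y" for x y using re im by (simp add: complex_eq_iff)
  have uniq: "u = v" if "\<And>y. cinner u y = cinner v y" for u v :: 'a
    by (rule cinner_right_unique) (metis that cinner_commute)
  have "bounded_clinear B"
  proof (rule bounded_clinearI)
    show "B (x + y) = B x + B y" for x y
      by (rule uniq) (simp add: c.add_left flip: eq, simp add: add_left)
    show "B (c *\<^sub>C x) = c *\<^sub>C B x" for c x
      by (rule uniq) (simp add: c.scale_left flip: eq, simp add: scale_left)
    show "norm (B x) \<le> norm x * K" for x
    proof (cases "B x = 0")
      case False
      have "(norm (B x))\<^sup>2 = Re (b x (B x))" by (simp add: B power2_norm_eq_inner)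
      also have "\<dots> \<le> K * norm x * norm (B x)" by (rule order_trans[OF complex_Re_le_cmod K(2)])
      finally show ?thesis using False by (simp add: power2_eq_square mult_ac)
    qed (use K(1) in simp)
  qed
  then show ?thesis using eq by blast
qed

text \<open>
  For small \<open>t > 0\<close> the map \<open>x \<mapsto> x - t (G x - y)\<close> is a contraction, and its fixed point solves
  \<open>G x = y\<close>.
\<close>

lemma coercive_operator_surj:
  fixes G :: "'a::{real_inner, complete_space} \<Rightarrow> 'a"
  assumes G: "bounded_linear G" and e: "e > 0" "\<And>x. e * (norm x)\<^sup>2 \<le> inner (G x) x"
  shows "\<exists>x. G x = y"
proof -
  interpret bounded_linear G by fact
  obtain K0 where K0: "K0 > 0" "\<And>x. norm (G x) \<le> norm x * K0" using pos_bounded by blast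
  \<comment> \<open>Enlarging the bound to at least \<open>e\<close> keeps the radicand in \<open>\<theta>\<close> nonnegative even on the zero space.\<close>
  define K where "K = max K0 e"
  have K: "K > 0" "e \<le> K" using e(1) by (auto simp: K_def)
  have KG: "norm (G x) \<le> K * norm x" for x
    using K0(2)[of x] mult_right_mono[of K0 K "norm x"] by (simp add: K_def mult.commute)
  \<comment> \<open>This value minimizes the bound \<open>1 - 2 t e + t\<^sup>2 K\<^sup>2\<close> for the squared contraction factor.\<close>
  define t where "t = e / K\<^sup>2"
  define \<theta> where "\<theta> = sqrt (1 - (e / K)\<^sup>2)"
  have t: "t > 0" using e(1) K by (simp add: t_def)
  have eK: "0 < e / K" "e / K \<le> 1" using e(1) K by auto
  then have eK2: "0 < (e / K)\<^sup>2" "(e / K)\<^sup>2 \<le> 1" by (auto simp: power_le_one)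
  have \<theta>: "0 \<le> \<theta>" "\<theta> < 1" using eK2 by (auto simp: \<theta>_def)
  have contr: "norm (x - t *\<^sub>R G x) \<le> \<theta> * norm x" for x
  proof -
    have "(norm (x - t *\<^sub>R G x))\<^sup>2 = (norm x)\<^sup>2 - 2 * t * inner (G x) x + t\<^sup>2 * (norm (G x))\<^sup>2"
      unfolding power2_norm_eq_inner
      by (simp add: inner_diff_left inner_diff_right inner_commute algebra_simps power2_eq_square)
    also have "\<dots> \<le> (norm x)\<^sup>2 - 2 * t * (e * (norm x)\<^sup>2) + t\<^sup>2 * (K * norm x)\<^sup>2"
      using e(2)[of x] t KG[of x] K
      by (intro add_mono diff_mono mult_left_mono power_mono) auto
    also have "\<dots> = (1 - (e / K)\<^sup>2) * (norm x)\<^sup>2"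
      using K by (simp add: t_def field_simps power2_eq_square)
    also have "\<dots> = (\<theta> * norm x)\<^sup>2"
      using eK2 by (simp add: \<theta>_def power_mult_distrib)
    finally show ?thesis
      using \<theta> by (intro power2_le_imp_le[of "norm (x - t *\<^sub>R G x)"]) auto
  qed
  have "\<exists>!x\<in>UNIV. x - t *\<^sub>R (G x - y) = x"
  proof (rule Banach_fix[of UNIV \<theta>])
    fix u v :: 'a
    have "(u - t *\<^sub>R (G u - y)) - (v - t *\<^sub>R (G v - y)) = (u - v) - t *\<^sub>R G (u - v)"
      by (simp add: diff algebra_simps)
    then show "dist (u - t *\<^sub>R (G u - y)) (v - t *\<^sub>R (G v - y)) \<le> \<theta> * dist u v"
      using contr[of "u - v"] unfolding dist_norm by (simp only:)
  qed (use \<theta> in \<open>auto simp: complete_UNIV\<close>)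
  then show ?thesis using t by auto
qed

text \<open>
  Every operator below that is the inverse of another one, namely the resolvents and the solution
  operators of a pencil, comes from this statement.
\<close>

lemma lax_milgram:
  fixes g b :: "'a::chilbert_space \<Rightarrow> 'a \<Rightarrow> complex"
  assumes g: "bounded_sesquilinear g" and b: "bounded_sesquilinear b"
    and e: "e > 0" "\<And>x. e * (norm x)\<^sup>2 \<le> Re (g x x)"
  shows "\<exists>P. bounded_clinear P \<and> (\<forall>x y. g (P x) y = b x y)"
proof -
  interpret g: bounded_sesquilinear g by fact
  interpret b: bounded_sesquilinear b by fact
  obtain G where G: "bounded_clinear G" "\<And>x y. g x y = cinner (G x) y"
    using bounded_sesquilinear_operator[OF g] by blast
  obtain B where B: "bounded_clinear B" "\<And>x y. b x y = cinner (B x) y"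
    using bounded_sesquilinear_operator[OF b] by blast
  have "\<exists>u. G u = B x" for x
    by (rule coercive_operator_surj[of G e])
      (use G e in \<open>auto simp: bounded_clinear_def Re_cinner\<close>)
  then obtain P where P: "\<And>x. G (P x) = B x" by metis
  have eq: "g (P x) y = b x y" for x y by (simp add: G B P)
  have uniq: "u = v" if "\<And>y. g u y = g v y" for u v
  proof -
    have "g (u - v) (u - v) = 0" using that by (simp add: g.diff_left)
    then show ?thesis using e(1) e(2)[of "u - v"] by (simp add: mult_le_0_iff)
  qed
  obtain K where K: "K > 0" "\<And>x y. cmod (b x y) \<le> K * norm x * norm y" using b.bound by blast
  have "bounded_clinear P"
  proof (rule bounded_clinearI)
    show "P (x + y) = P x + P y" for x y
      by (rule uniq) (simp add: g.add_left eq b.add_left)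
    show "P (c *\<^sub>C x) = c *\<^sub>C P x" for c x
      by (rule uniq) (simp add: g.scale_left eq b.scale_left)
    show "norm (P x) \<le> norm x * (K / e)" for x
    proof (cases "P x = 0")
      case False
      have "e * (norm (P x))\<^sup>2 \<le> Re (b x (P x))" using e(2)[of "P x"] by (simp add: eq)
      also have "\<dots> \<le> K * norm x * norm (P x)" by (rule order_trans[OF complex_Re_le_cmod K(2)])
      finally show ?thesis using False e(1) by (simp add: power2_eq_square field_simps)
    qed (use K(1) e(1) in simp)
  qed
  then show ?thesis using eq by blast
qed

section \<open>Averages over roots of unity\<close>

text \<open>
  The mean over the unit circle is the limit of the averages over the \<open>N\<close>-th roots of unity. These
  are finite sums, so linearity and positivity hold for arbitrary functions, and continuity in \<open>z\<close>
  never has to be discussed.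
\<close>

definition circle_average :: "nat \<Rightarrow> (complex \<Rightarrow> complex) \<Rightarrow> complex"
  where "circle_average N f = (\<Sum>k<N. f (cis (2 * pi * real k / real N))) / of_nat N"

definition mean_zero :: "(complex \<Rightarrow> complex) \<Rightarrow> bool"
  where "mean_zero f \<longleftrightarrow> (\<lambda>N. circle_average N f) \<longlonglongrightarrow> 0"

lemma mean_zero_add:
  assumes "mean_zero f" "mean_zero g"
  shows "mean_zero (\<lambda>z. f z + g z)"
  using tendsto_add[OF assms[unfolded mean_zero_def]]
  by (simp add: mean_zero_def circle_average_def sum.distrib add_divide_distrib)

lemma mean_zero_scale:
  assumes "mean_zero f"
  shows "mean_zero (\<lambda>z. c * f z)"
  using tendsto_mult_left[OF assms[unfolded mean_zero_def], of c]
  by (simp add: mean_zero_def circle_average_def sum_distrib_left)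

lemma mean_zero_cnj:
  assumes "mean_zero f"
  shows "mean_zero (\<lambda>z. cnj (f z))"
  using tendsto_cnj[OF assms[unfolded mean_zero_def]]
  by (simp add: mean_zero_def circle_average_def)

lemma mean_zero_sum:
  assumes "\<And>i. i \<in> I \<Longrightarrow> mean_zero (f i)"
  shows "mean_zero (\<lambda>z. \<Sum>i\<in>I. f i z)"
  using assms
proof (induction I rule: infinite_finite_induct)
  case (insert i I)
  then show ?case using mean_zero_add[of "f i" "\<lambda>z. \<Sum>i\<in>I. f i z"] by simp
qed (simp_all add: mean_zero_def circle_average_def)

lemma norm_circle_average_le:
  assumes "\<And>z. cmod z = 1 \<Longrightarrow> cmod (f z) \<le> e" "e \<ge> 0"
  shows "cmod (circle_average N f) \<le> e"
proof (cases "N = 0")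
  case False
  have "cmod (\<Sum>k<N. f (cis (2 * pi * real k / real N))) \<le> (\<Sum>k<N. e)"
    by (intro sum_norm_le assms) simp
  then show ?thesis using False by (simp add: circle_average_def norm_divide field_simps)
qed (use assms in \<open>simp add: circle_average_def\<close>)

lemma circle_average_power:
  assumes "0 < m" "m < N"
  shows "circle_average N (\<lambda>z. z ^ m) = 0"
proof -
  define w where "w = cis (2 * pi * real m / real N)"
  have pw: "cis (2 * pi * real k / real N) ^ m = w ^ k" for k
    unfolding w_def Complex.DeMoivre by (rule arg_cong[of _ _ cis]) (simp add: mult_ac)
  have "w ^ N = 1"
    using assms cis_multiple_2pi[of "real m"] unfolding w_def Complex.DeMoivre by (simp add: mult_ac)
  moreover have "w \<noteq> 1"
  proof
    assume "w = 1"
    then have "cos (2 * pi * real m / real N) = 1" by (simp add: w_def complex_eq_iff)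
    then obtain j :: int where "2 * pi * real m / real N = of_int j * (2 * pi)"
      using cos_one_2pi_int by auto
    then have "real m = of_int j * real N" using assms by (simp add: field_simps)
    then have "int m = j * int N" by (metis of_int_eq_iff of_int_mult of_int_of_nat_eq)
    then have "int N dvd int m" by simp
    then show False using assms by (simp add: nat_dvd_not_less)
  qed
  ultimately have "(\<Sum>k<N. w ^ k) = 0" by (simp add: geometric_sum)
  then show ?thesis by (simp add: circle_average_def pw)
qed

lemma mean_zero_power:
  assumes "0 < m"
  shows "mean_zero (\<lambda>z. z ^ m)"
  unfolding mean_zero_def
  by (rule tendsto_eventually, rule eventually_mono[OF eventually_gt_at_top[of m]])
    (rule circle_average_power[OF assms])

lemma mean_zero_uniform_limit:
  assumes "\<And>e. e > 0 \<Longrightarrow> \<exists>g. mean_zero g \<and> (\<forall>z. cmod z = 1 \<longrightarrow> cmod (f z - g z) \<le> e)"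
  shows "mean_zero f"
  unfolding mean_zero_def
proof (rule LIMSEQ_I)
  fix e :: real assume e: "e > 0"
  obtain g where g: "mean_zero g" "\<And>z. cmod z = 1 \<Longrightarrow> cmod (f z - g z) \<le> e / 2"
    using assms[of "e / 2"] e by auto
  obtain N0 where N0: "\<And>N. N \<ge> N0 \<Longrightarrow> cmod (circle_average N g) < e / 2"
    using LIMSEQ_D[OF g(1)[unfolded mean_zero_def], of "e / 2"] e by auto
  have "cmod (circle_average N f) < e" if "N \<ge> N0" for N
  proof -
    have "circle_average N f = circle_average N (\<lambda>z. f z - g z) + circle_average N g"
      by (simp add: circle_average_def sum_subtractf diff_divide_distrib)
    also have "cmod \<dots> \<le> cmod (circle_average N (\<lambda>z. f z - g z)) + cmod (circle_average N g)"
      by (rule norm_triangle_ineq)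
    also have "\<dots> < e / 2 + e / 2"
      by (intro add_le_less_mono norm_circle_average_le g(2) N0[OF that]) (use e in auto)
    finally show ?thesis by simp
  qed
  then show "\<exists>no. \<forall>n\<ge>no. cmod (circle_average n f - 0) < e" by auto
qed

lemma mean_zero_cong:
  assumes "mean_zero f" "\<And>z. cmod z = 1 \<Longrightarrow> g z = f z"
  shows "mean_zero g"
  using assms by (intro mean_zero_uniform_limit) (auto intro!: exI[of _ f])

section \<open>Analytic functions on the circle that vanish at the origin\<close>

text \<open>
  On the circle these are the uniform limits of polynomials in \<open>z\<close> without constant term. Working with
  approximation instead of power series makes the class visibly closed under every operation used.
\<close>

definition analytic0 :: "(complex \<Rightarrow> 'a::complex_inner) \<Rightarrow> bool"
  where "analytic0 f \<longleftrightarrow> (\<forall>e>0. \<exists>N c. \<forall>z. cmod z = 1 \<longrightarrow>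
    norm (f z - (\<Sum>j<N. z ^ Suc j *\<^sub>C c j)) \<le> e)"

lemma analytic0_uniform_limit:
  assumes "\<And>e. e > 0 \<Longrightarrow> \<exists>g. analytic0 g \<and> (\<forall>z. cmod z = 1 \<longrightarrow> norm (f z - g z) \<le> e)"
  shows "analytic0 f"
  unfolding analytic0_def
proof (intro allI impI)
  fix e :: real assume e: "e > 0"
  obtain g where g: "analytic0 g" "\<And>z. cmod z = 1 \<Longrightarrow> norm (f z - g z) \<le> e / 2"
    using assms[of "e / 2"] e by auto
  obtain N c where "\<And>z. cmod z = 1 \<Longrightarrow> norm (g z - (\<Sum>j<N. z ^ Suc j *\<^sub>C c j)) \<le> e / 2"
    using g(1) e unfolding analytic0_def by (metis half_gt_zero)
  then have "norm (f z - (\<Sum>j<N. z ^ Suc j *\<^sub>C c j)) \<le> e" if "cmod z = 1" for z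
    using norm_triangle_ineq[of "f z - g z" "g z - (\<Sum>j<N. z ^ Suc j *\<^sub>C c j)"] g(2)[OF that] that
    by fastforce
  then show "\<exists>N c. \<forall>z. cmod z = 1 \<longrightarrow> norm (f z - (\<Sum>j<N. z ^ Suc j *\<^sub>C c j)) \<le> e"
    by blast
qed

lemma analytic0_cong:
  assumes "analytic0 g" "\<And>z. cmod z = 1 \<Longrightarrow> f z = g z"
  shows "analytic0 f"
  by (rule analytic0_uniform_limit) (use assms in \<open>auto intro!: exI[of _ g]\<close>)

lemma analytic0_add:
  fixes f g :: "complex \<Rightarrow> 'a::complex_inner"
  assumes "analytic0 f" "analytic0 g"
  shows "analytic0 (\<lambda>z. f z + g z)"
  unfolding analytic0_def
proof (intro allI impI)
  fix e :: real assume e: "e > 0"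
  obtain N c where N: "\<And>z. cmod z = 1 \<Longrightarrow> norm (f z - (\<Sum>j<N. z ^ Suc j *\<^sub>C c j)) \<le> e / 2"
    using assms(1) e unfolding analytic0_def by (metis half_gt_zero)
  obtain M d where M: "\<And>z. cmod z = 1 \<Longrightarrow> norm (g z - (\<Sum>j<M. z ^ Suc j *\<^sub>C d j)) \<le> e / 2"
    using assms(2) e unfolding analytic0_def by (metis half_gt_zero)
  \<comment> \<open>Padding by zeros gives the two approximating polynomials a common degree.\<close>
  define pad where "pad K (c :: nat \<Rightarrow> 'a) j = (if j < K then c j else 0)" for K c j
  have pad: "(\<Sum>j<K. z ^ Suc j *\<^sub>C c j) = (\<Sum>j<max N M. z ^ Suc j *\<^sub>C pad K c j)"
    if "K \<le> max N M" for z c K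
    by (rule sum.mono_neutral_cong_left) (use that in \<open>auto simp: pad_def\<close>)
  have "norm (f z + g z - (\<Sum>j<max N M. z ^ Suc j *\<^sub>C (pad N c j + pad M d j))) \<le> e"
    if z: "cmod z = 1" for z
  proof -
    have "f z + g z - (\<Sum>j<max N M. z ^ Suc j *\<^sub>C (pad N c j + pad M d j))
      = (f z - (\<Sum>j<N. z ^ Suc j *\<^sub>C c j)) + (g z - (\<Sum>j<M. z ^ Suc j *\<^sub>C d j))"
      by (simp add: pad[OF max.cobounded1] pad[OF max.cobounded2] scaleC_add_right sum.distrib del: power_Suc)
    also have "norm \<dots> \<le> e / 2 + e / 2"
      by (rule order_trans[OF norm_triangle_ineq]) (intro add_mono N M z)
    finally show ?thesis by simp
  qed
  then show "\<exists>N c. \<forall>z. cmod z = 1 \<longrightarrow> norm (f z + g z - (\<Sum>j<N. z ^ Suc j *\<^sub>C c j)) \<le> e"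
    by (intro exI[of _ "max N M"] exI[of _ "\<lambda>j. pad N c j + pad M d j"]) simp
qed

lemma analytic0_linear_image:
  assumes "bounded_clinear A" "analytic0 f"
  shows "analytic0 (\<lambda>z. A (f z))"
  unfolding analytic0_def
proof (intro allI impI)
  fix e :: real assume e: "e > 0"
  obtain K where K: "K > 0" "\<And>x. norm (A x) \<le> K * norm x"
    using bounded_clinear_bound[OF assms(1)] by blast
  obtain N c where N: "\<And>z. cmod z = 1 \<Longrightarrow> norm (f z - (\<Sum>j<N. z ^ Suc j *\<^sub>C c j)) \<le> e / K"
    using assms(2) e K(1) unfolding analytic0_def by (metis divide_pos_pos)
  have "norm (A (f z) - (\<Sum>j<N. z ^ Suc j *\<^sub>C A (c j))) \<le> e" if z: "cmod z = 1" for z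
  proof -
    have "A (f z) - (\<Sum>j<N. z ^ Suc j *\<^sub>C A (c j)) = A (f z - (\<Sum>j<N. z ^ Suc j *\<^sub>C c j))"
      by (simp only: bounded_clinearD[OF assms(1)])
    also have "norm \<dots> \<le> K * (e / K)"
      by (rule order_trans[OF K(2)]) (use N[OF z] K(1) in \<open>intro mult_left_mono; simp\<close>)
    finally show ?thesis using K(1) by simp
  qed
  then show "\<exists>N c. \<forall>z. cmod z = 1 \<longrightarrow> norm (A (f z) - (\<Sum>j<N. z ^ Suc j *\<^sub>C c j)) \<le> e"
    by (intro exI[of _ N] exI[of _ "\<lambda>j. A (c j)"]) simp
qed

lemma analytic0_linear: "analytic0 (\<lambda>z. z *\<^sub>C x)"
  unfolding analytic0_def by (intro allI impI exI[of _ 1] exI[of _ "\<lambda>_. x"]) simp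

lemma analytic0_zero: "analytic0 (\<lambda>z. 0)"
  using analytic0_linear[of 0] by simp

lemma analytic0_shift:
  assumes "analytic0 f"
  shows "analytic0 (\<lambda>z. z *\<^sub>C f z)"
  unfolding analytic0_def
proof (intro allI impI)
  fix e :: real assume e: "e > 0"
  obtain N c where N: "\<And>z. cmod z = 1 \<Longrightarrow> norm (f z - (\<Sum>j<N. z ^ Suc j *\<^sub>C c j)) \<le> e"
    using assms e unfolding analytic0_def by metis
  have "norm (z *\<^sub>C f z - (\<Sum>j<Suc N. z ^ Suc j *\<^sub>C (case j of 0 \<Rightarrow> 0 | Suc i \<Rightarrow> c i))) \<le> e"
    if z: "cmod z = 1" for z
  proof -
    have "z *\<^sub>C f z - (\<Sum>j<Suc N. z ^ Suc j *\<^sub>C (case j of 0 \<Rightarrow> 0 | Suc i \<Rightarrow> c i))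
      = z *\<^sub>C (f z - (\<Sum>j<N. z ^ Suc j *\<^sub>C c j))"
      by (simp add: sum.lessThan_Suc_shift scaleC_diff_right scaleC_sum_right scaleC_scaleC
          del: sum.lessThan_Suc)
    then show ?thesis using N[OF z] z by (simp add: norm_scaleC)
  qed
  then show "\<exists>N c. \<forall>z. cmod z = 1 \<longrightarrow> norm (z *\<^sub>C f z - (\<Sum>j<N. z ^ Suc j *\<^sub>C c j)) \<le> e"
    by blast
qed

lemma analytic0_scaleC: "analytic0 f \<Longrightarrow> analytic0 (\<lambda>z. c *\<^sub>C f z)"
  by (rule analytic0_linear_image[OF bounded_clinear_scaleC[OF bounded_clinear_id]])

lemma analytic0_sum:
  "(\<And>i. i \<in> I \<Longrightarrow> analytic0 (f i)) \<Longrightarrow> analytic0 (\<lambda>z. \<Sum>i\<in>I. f i z)"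
  by (induction I rule: infinite_finite_induct) (auto intro: analytic0_add analytic0_zero)

lemma analytic0_power_mult: "analytic0 f \<Longrightarrow> analytic0 (\<lambda>z. z ^ n *\<^sub>C f z)"
proof (induction n)
  case (Suc n)
  then show ?case using analytic0_shift[of "\<lambda>z. z ^ n *\<^sub>C f z"] by (simp add: scaleC_scaleC)
qed simp

lemma analytic0_bounded:
  assumes "analytic0 f"
  obtains B where "B > 0" "\<And>z. cmod z = 1 \<Longrightarrow> norm (f z) \<le> B"
proof -
  obtain N c where N: "\<And>z. cmod z = 1 \<Longrightarrow> norm (f z - (\<Sum>j<N. z ^ Suc j *\<^sub>C c j)) \<le> 1"
    using assms unfolding analytic0_def by (metis zero_less_one)
  have "norm (f z) \<le> 1 + (\<Sum>j<N. norm (c j))" if z: "cmod z = 1" for z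
  proof -
    have "norm (\<Sum>j<N. z ^ Suc j *\<^sub>C c j) \<le> (\<Sum>j<N. norm (c j))"
      by (rule sum_norm_le) (use z in \<open>simp add: norm_scaleC norm_mult norm_power\<close>)
    then show ?thesis
      using norm_triangle_ineq[of "f z - (\<Sum>j<N. z ^ Suc j *\<^sub>C c j)" "\<Sum>j<N. z ^ Suc j *\<^sub>C c j"] N[OF z]
      by simp
  qed
  then show ?thesis using that[of "1 + (\<Sum>j<N. norm (c j))"] by (simp add: add_pos_nonneg sum_nonneg)
qed

text \<open>
  This is spectral radius less than one, in the form in which Neumann series use it. Unlike a bound
  \<open>\<parallel>K\<parallel> < 1\<close> it does not change under passage to an equivalent inner product.
\<close>

definition powers_vanish :: "('a::real_normed_vector \<Rightarrow> 'a) \<Rightarrow> bool"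
  where "powers_vanish K \<longleftrightarrow> (\<forall>e>0. \<exists>n. \<forall>x. norm ((K ^^ n) x) \<le> e * norm x)"

text \<open>
  Iterating the equation gives \<open>d z = (\<Sum>j<n. z ^ j K ^ j (g z)) + z ^ n K ^ n (d z)\<close>, whose last
  term is uniformly small.
\<close>

lemma analytic0_fixpoint:
  assumes K: "bounded_clinear K" "powers_vanish K" and g: "analytic0 g"
    and d: "\<And>z. cmod z = 1 \<Longrightarrow> d z = g z + z *\<^sub>C K (d z)"
    and B: "\<And>z. cmod z = 1 \<Longrightarrow> norm (d z) \<le> B"
  shows "analytic0 d"
proof (rule analytic0_uniform_limit)
  fix e :: real assume e: "e > 0"
  have expand: "d z = (\<Sum>j<n. z ^ j *\<^sub>C (K ^^ j) (g z)) + z ^ n *\<^sub>C (K ^^ n) (d z)"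
    if z: "cmod z = 1" for z n
  proof (induction n)
    case (Suc n)
    have "(K ^^ n) (d z) = (K ^^ n) (g z + z *\<^sub>C K (d z))"
      by (rule arg_cong[OF d[OF z]])
    also have "\<dots> = (K ^^ n) (g z) + z *\<^sub>C (K ^^ Suc n) (d z)"
      by (simp only: bounded_clinearD[OF bounded_clinear_funpow[OF K(1)]] funpow_Suc_right o_apply)
    finally have "z ^ n *\<^sub>C (K ^^ n) (d z)
        = z ^ n *\<^sub>C (K ^^ n) (g z) + z ^ Suc n *\<^sub>C (K ^^ Suc n) (d z)"
      by (simp only: scaleC_add_right scaleC_scaleC power_Suc2)
    with Suc show ?case by (simp only: sum.lessThan_Suc add.assoc)
  qed simp
  have "norm (d 1) \<le> B" by (rule B) simp
  then have B0: "B \<ge> 0" by (rule order_trans[OF norm_ge_zero])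
  obtain n where n: "\<And>x. norm ((K ^^ n) x) \<le> e / (B + 1) * norm x"
    using K(2)[unfolded powers_vanish_def, rule_format, of "e / (B + 1)"] e B0 by auto
  show "\<exists>g. analytic0 g \<and> (\<forall>z. cmod z = 1 \<longrightarrow> norm (d z - g z) \<le> e)"
  proof (intro exI conjI allI impI)
    show "analytic0 (\<lambda>z. \<Sum>j<n. z ^ j *\<^sub>C (K ^^ j) (g z))"
      by (intro analytic0_sum analytic0_power_mult 
          analytic0_linear_image[OF bounded_clinear_funpow[OF K(1)] g])
    fix z :: complex assume z: "cmod z = 1"
    have "norm (d z - (\<Sum>j<n. z ^ j *\<^sub>C (K ^^ j) (g z))) = norm ((K ^^ n) (d z))"
      by (subst expand[OF z, of n]) (simp add: norm_scaleC norm_power z)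
    also have "\<dots> \<le> e / (B + 1) * B"
      by (rule order_trans[OF n]) (use B[OF z] e B0 in \<open>intro mult_left_mono; simp\<close>)
    also have "\<dots> \<le> e" using e B0 by (simp add: field_simps)
    finally show "norm (d z - (\<Sum>j<n. z ^ j *\<^sub>C (K ^^ j) (g z))) \<le> e" .
  qed
qed

text \<open>
  Pairing a function with positive frequencies with an anti-analytic one leaves only positive
  frequencies, because the form is conjugate-linear in its second argument. The factor \<open>z\<close> in the
  second hypothesis allows a constant term in \<open>g\<close>.
\<close>

lemma (in bounded_sesquilinear) mean_zero_analytic0:
  assumes f: "analytic0 f" and g: "analytic0 (\<lambda>z. z *\<^sub>C g (cnj z))"
  shows "mean_zero (\<lambda>z. b (f z) (g z))"
proof (rule mean_zero_uniform_limit)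
  fix e :: real assume e: "e > 0"
  obtain K where K: "K > 0" "\<And>x y. cmod (b x y) \<le> K * norm x * norm y" using bound by blast
  obtain B where B: "B > 0" "\<And>z. cmod z = 1 \<Longrightarrow> norm (f z) \<le> B" using analytic0_bounded[OF f] by blast
  obtain C where C: "C > 0" "\<And>z. cmod z = 1 \<Longrightarrow> norm (z *\<^sub>C g (cnj z)) \<le> C"
    using analytic0_bounded[OF g] by blast
  define \<delta> where "\<delta> = min 1 (e / (K * (B + C + 1)))"
  have \<delta>: "\<delta> > 0" "\<delta> \<le> 1" using e K(1) B(1) C(1) by (auto simp: \<delta>_def)
  have \<delta>e: "K * (B + C + 1) * \<delta> \<le> e"
  proof -
    have "K * (B + C + 1) * \<delta> \<le> K * (B + C + 1) * (e / (K * (B + C + 1)))"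
      using K(1) B(1) C(1) by (intro mult_left_mono) (auto simp: \<delta>_def)
    also have "\<dots> = e" using K(1) B(1) C(1) by simp
    finally show ?thesis .
  qed
  obtain N c where c: "\<And>z. cmod z = 1 \<Longrightarrow> norm (f z - (\<Sum>j<N. z ^ Suc j *\<^sub>C c j)) \<le> \<delta>"
    using f \<delta>(1) unfolding analytic0_def by metis
  obtain M d where d: "\<And>z. cmod z = 1 \<Longrightarrow> norm (z *\<^sub>C g (cnj z) - (\<Sum>j<M. z ^ Suc j *\<^sub>C d j)) \<le> \<delta>"
    using g \<delta>(1) unfolding analytic0_def by metis
  define u where "u z = (\<Sum>j<N. z ^ Suc j *\<^sub>C c j)" for z
  define v where "v z = (\<Sum>j<M. cnj z ^ j *\<^sub>C d j)" for z
  have cd: "z * cnj z = 1" if "cmod z = 1" for z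
    using complex_norm_square[of z] that by simp
  have gv: "norm (g z - v z) \<le> \<delta>" and gC: "norm (g z) \<le> C" if z: "cmod z = 1" for z
  proof -
    have "g z - v z = z *\<^sub>C (cnj z *\<^sub>C g z - (\<Sum>j<M. cnj z ^ Suc j *\<^sub>C d j))"
      using cd[OF z]
      by (simp add: v_def scaleC_diff_right scaleC_scaleC scaleC_sum_right mult.assoc[symmetric])
    then show "norm (g z - v z) \<le> \<delta>" using d[of "cnj z"] z by (simp add: norm_scaleC)
    show "norm (g z) \<le> C" using C(2)[of "cnj z"] z by (simp add: norm_scaleC)
  qed
  have "mean_zero (\<lambda>z. b (u z) (v z))"
  proof -
    have "b (u z) (v z) = (\<Sum>i<N. \<Sum>j<M. b (c i) (d j) * z ^ (Suc i + j))" for z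
      unfolding u_def v_def sum_left sum_right
      by (subst sum.swap) (simp add: scale_left scale_right power_add mult_ac sum_distrib_left)
    then show ?thesis
      by (simp only:) (intro mean_zero_sum mean_zero_scale mean_zero_power, simp)
  qed
  moreover have "cmod (b (f z) (g z) - b (u z) (v z)) \<le> e" if z: "cmod z = 1" for z
  proof -
    have fu: "norm (f z - u z) \<le> \<delta>" using c[OF z] by (simp add: u_def)
    have vC: "norm (v z) \<le> C + 1"
      using norm_triangle_ineq4[of "g z" "g z - v z"] gv[OF z] gC[OF z] \<delta> by simp
    have "b (f z) (g z) - b (u z) (v z) = b (f z) (g z - v z) + b (f z - u z) (v z)"
      by (simp add: diff_left diff_right)
    also have "cmod \<dots> \<le> K * norm (f z) * norm (g z - v z) + K * norm (f z - u z) * norm (v z)"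
      by (intro norm_triangle_le add_mono K)
    also have "\<dots> \<le> K * B * \<delta> + K * \<delta> * (C + 1)"
      using K(1) B(1) C(1) \<delta> B(2)[OF z] gv[OF z] fu vC
      by (intro add_mono mult_mono) (auto intro: mult_nonneg_nonneg)
    also have "\<dots> = K * (B + C + 1) * \<delta>" by (simp add: algebra_simps)
    finally show ?thesis using \<delta>e by linarith
  qed
  ultimately show "\<exists>h. mean_zero h \<and> (\<forall>z. cmod z = 1 \<longrightarrow> cmod (b (f z) (g z) - h z) \<le> e)"
    by blast
qed

section \<open>Defects, resolvents and transference to the circle\<close>

text \<open>
  \<^term>\<open>defect Q X\<close> is the form of \<open>I - X* X\<close>, the adjoint being taken with respect to \<open>Q\<close>.
\<close>

definition defect :: "('a \<Rightarrow> 'a \<Rightarrow> complex) \<Rightarrow> ('a \<Rightarrow> 'a) \<Rightarrow> 'a \<Rightarrow> 'a \<Rightarrow> complex"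
  where "defect Q X = (\<lambda>x y. Q x y - Q (X x) (X y))"

lemma coercive_form_defect:
  assumes "coercive_form Q" "bounded_clinear X"
    and e: "e > 0" "\<And>x. e * (norm x)\<^sup>2 \<le> Re (Q x x) - Re (Q (X x) (X x))"
  shows "coercive_form (defect Q X)"
proof -
  interpret Q: coercive_form Q by fact
  interpret D: bounded_sesquilinear "defect Q X"
    unfolding defect_def
    by (rule bounded_sesquilinear_diff[OF Q.bounded_sesquilinear_axioms
          bounded_sesquilinear_compose[OF Q.bounded_sesquilinear_axioms assms(2) assms(2)]])
  show ?thesis
  proof
    show "defect Q X y x = cnj (defect Q X x y)" for x y
      using Q.hermitian[of x y] Q.hermitian[of "X x" "X y"] by (simp add: defect_def)
    show "\<exists>e>0. \<forall>x. e * (norm x)\<^sup>2 \<le> Re (defect Q X x x)"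
      using e by (auto simp: defect_def)
  qed
qed

text \<open>
  The hypothesis says that \<open>K\<close> is a strict contraction in the norm of the form, because that norm is
  equivalent to the given one.
\<close>

lemma (in coercive_form) powers_vanish:
  assumes e: "e > 0" "\<And>x. e * (norm x)\<^sup>2 \<le> Re (b x x) - Re (b (K x) (K x))"
  shows "powers_vanish K"
proof -
  obtain L0 where L0: "L0 > 0" "\<And>x y. cmod (b x y) \<le> L0 * norm x * norm y" using bound by blast
  obtain c where c: "c > 0" "\<And>x. c * (norm x)\<^sup>2 \<le> Re (b x x)" using coercive by blast
  \<comment> \<open>Enlarging the bound to at least \<open>e\<close> makes \<open>\<theta>\<close> nonnegative even on the zero space.\<close>
  define L where "L = max L0 e"
  have L: "L > 0" "e \<le> L" using L0(1) by (auto simp: L_def)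
  have bL: "Re (b x x) \<le> L * (norm x)\<^sup>2" for x
  proof -
    have "Re (b x x) \<le> L0 * norm x * norm x" by (rule order_trans[OF complex_Re_le_cmod L0(2)])
    also have "\<dots> \<le> L * (norm x)\<^sup>2" by (simp add: L_def power2_eq_square mult_right_mono mult.assoc)
    finally show ?thesis .
  qed
  define \<theta> where "\<theta> = 1 - e / L"
  have \<theta>: "0 \<le> \<theta>" "\<theta> < 1" using L e(1) by (auto simp: \<theta>_def)
  have step: "Re (b (K x) (K x)) \<le> \<theta> * Re (b x x)" for x
  proof -
    have "e / L * Re (b x x) \<le> e / L * (L * (norm x)\<^sup>2)"
      using e(1) L(1) by (intro mult_left_mono bL) simp
    also have "\<dots> = e * (norm x)\<^sup>2" using L by simp
    finally show ?thesis using e(2)[of x] by (simp add: \<theta>_def left_diff_distrib)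
  qed
  have iter: "Re (b ((K ^^ n) x) ((K ^^ n) x)) \<le> \<theta> ^ n * Re (b x x)" for n x
  proof (induction n)
    case (Suc n)
    have "Re (b ((K ^^ Suc n) x) ((K ^^ Suc n) x)) \<le> \<theta> * Re (b ((K ^^ n) x) ((K ^^ n) x))"
      using step[of "(K ^^ n) x"] by simp
    also have "\<dots> \<le> \<theta> * (\<theta> ^ n * Re (b x x))" by (rule mult_left_mono[OF Suc \<theta>(1)])
    finally show ?case by (simp add: mult.assoc)
  qed simp
  show ?thesis
    unfolding powers_vanish_def
  proof (intro allI impI)
    fix d :: real assume d: "d > 0"
    then have "c * d\<^sup>2 / L > 0" using c L by simp
    then obtain n where n: "\<theta> ^ n < c * d\<^sup>2 / L" using real_arch_pow_inv \<theta>(2) by blast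
    have "norm ((K ^^ n) x) \<le> d * norm x" for x
    proof -
      have "c * (norm ((K ^^ n) x))\<^sup>2 \<le> \<theta> ^ n * Re (b x x)" by (rule order_trans[OF c(2) iter])
      also have "\<dots> \<le> c * d\<^sup>2 / L * (L * (norm x)\<^sup>2)"
        using n \<theta> nonneg c(1) L(1) by (intro mult_mono bL) auto
      also have "\<dots> = c * (d * norm x)\<^sup>2" using L by (simp add: power_mult_distrib)
      finally have "(norm ((K ^^ n) x))\<^sup>2 \<le> (d * norm x)\<^sup>2" using c(1) by simp
      then show ?thesis by (rule power2_le_imp_le) (use d in simp)
    qed
    then show "\<exists>n. \<forall>x. norm ((K ^^ n) x) \<le> d * norm x" by blast
  qed
qed

text \<open>
  For a strict contraction and \<open>\<bar>z\<bar> = 1\<close> this is \<open>(1 - cnj z X)\<^sup>-\<^sup>1 h = (\<Sum>j. cnj z ^ j X ^ j h)\<close>, the value at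
  \<open>z\<close> of the Fourier series of the sequence \<open>(X ^ j h)\<close> in the Hardy space of the defect form.
\<close>

definition resolvent :: "('a::complex_inner \<Rightarrow> 'a) \<Rightarrow> complex \<Rightarrow> 'a \<Rightarrow> 'a"
  where "resolvent X z h = (THE u. u - cnj z *\<^sub>C X u = h)"

locale strict_contraction = Q: coercive_form Q + D: coercive_form "defect Q X"
  for Q :: "'a::chilbert_space \<Rightarrow> 'a \<Rightarrow> complex" and X +
  assumes X: "bounded_clinear X"
begin

abbreviation "R \<equiv> resolvent X"

text \<open>
  \<open>Re Q(z X u, u)\<close> is at most the mean of \<open>Q(X u, X u)\<close> and \<open>Q(u, u)\<close>, so that half of the defect
  survives.
\<close>

lemma half_coercive:
  obtains e where "e > 0"
    "\<And>z u. cmod z = 1 \<Longrightarrow> e * (norm u)\<^sup>2 \<le> Re (Q (u - z *\<^sub>C X u) u)"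
proof -
  obtain e where e: "e > 0" "\<And>x. e * (norm x)\<^sup>2 \<le> Re (defect Q X x x)" using D.coercive by blast
  have "e / 2 * (norm u)\<^sup>2 \<le> Re (Q (u - z *\<^sub>C X u) u)" if z: "cmod z = 1" for z u
    using Q.two_Re_le[of "z *\<^sub>C X u" u] e(2)[of u]
    by (simp add: Q.diff_left Q.quadratic_scale z defect_def)
  then show ?thesis using that[of "e / 2"] e(1) by simp
qed

lemma bounded_below:
  obtains c where "c > 0" "\<And>z u. cmod z = 1 \<Longrightarrow> c * norm u \<le> norm (u - z *\<^sub>C X u)"
proof -
  obtain e where e: "e > 0" "\<And>z u. cmod z = 1 \<Longrightarrow> e * (norm u)\<^sup>2 \<le> Re (Q (u - z *\<^sub>C X u) u)"
    using half_coercive by blast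
  obtain K where K: "K > 0" "\<And>x y. cmod (Q x y) \<le> K * norm x * norm y" using Q.bound by blast
  have "e / K * norm u \<le> norm (u - z *\<^sub>C X u)" if z: "cmod z = 1" for z u
  proof (cases "u = 0")
    case False
    have "e * (norm u)\<^sup>2 \<le> K * norm (u - z *\<^sub>C X u) * norm u"
      by (rule order_trans[OF e(2)[OF z] order_trans[OF complex_Re_le_cmod K(2)]])
    then show ?thesis using False K(1) by (simp add: power2_eq_square field_simps)
  qed simp
  then show ?thesis using that[of "e / K"] e(1) K(1) by simp
qed

lemma resolvent_exists:
  assumes "cmod z = 1"
  shows "\<exists>P. bounded_clinear P \<and> (\<forall>h. P h - cnj z *\<^sub>C X (P h) = h)"
proof -
  obtain e where e: "e > 0" "\<And>z u. cmod z = 1 \<Longrightarrow> e * (norm u)\<^sup>2 \<le> Re (Q (u - z *\<^sub>C X u) u)"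
    using half_coercive by blast
  have "bounded_clinear (\<lambda>u. u - cnj z *\<^sub>C X u)"
    by (intro bounded_clinear_diff bounded_clinear_id bounded_clinear_scaleC X)
  then have "bounded_sesquilinear (\<lambda>u k. Q (u - cnj z *\<^sub>C X u) k)"
    by (rule bounded_sesquilinear_compose[OF Q.bounded_sesquilinear_axioms _ bounded_clinear_id])
  from lax_milgram[OF this Q.bounded_sesquilinear_axioms e(1)]
  obtain P where P: "bounded_clinear P" "\<And>h k. Q (P h - cnj z *\<^sub>C X (P h)) k = Q h k"
    using e(2)[of "cnj z"] assms by auto
  have "P h - cnj z *\<^sub>C X (P h) - h = 0" for h
    by (rule Q.eq_zeroI, subst Q.diff_left) (simp only: P diff_self)
  then show ?thesis using P(1) by auto
qed

lemma resolvent_unique: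
  assumes z: "cmod z = 1" and u: "u - cnj z *\<^sub>C X u = h"
  shows "R z h = u"
  unfolding resolvent_def
proof (rule the_equality)
  fix v assume v: "v - cnj z *\<^sub>C X v = h"
  obtain c where c: "c > 0" "\<And>z u. cmod z = 1 \<Longrightarrow> c * norm u \<le> norm (u - z *\<^sub>C X u)"
    using bounded_below by blast
  have "(v - u) - cnj z *\<^sub>C X (v - u) = (v - cnj z *\<^sub>C X v) - (u - cnj z *\<^sub>C X u)"
    by (simp add: bounded_clinearD[OF X] scaleC_diff_right algebra_simps)
  also have "\<dots> = 0" by (simp only: u v diff_self)
  finally have "(v - u) - cnj z *\<^sub>C X (v - u) = 0" .
  then have "c * norm (v - u) \<le> 0" using c(2)[of "cnj z" "v - u"] z by simp
  then show "v = u" using c(1) by (simp add: mult_le_0_iff)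
qed (rule u)

lemma resolvent_bounded_clinear:
  assumes "cmod z = 1"
  shows "bounded_clinear (R z)"
proof -
  obtain P where P: "bounded_clinear P" "\<And>h. P h - cnj z *\<^sub>C X (P h) = h"
    using resolvent_exists[OF assms] by blast
  have "R z = P" by (rule ext) (rule resolvent_unique[OF assms P(2)])
  then show ?thesis using P(1) by simp
qed

lemma resolvent_eq:
  assumes "cmod z = 1"
  shows "R z h = h + cnj z *\<^sub>C X (R z h)"
proof -
  obtain P where P: "\<And>h. P h - cnj z *\<^sub>C X (P h) = h"
    using resolvent_exists[OF assms] by blast
  have "R z h = P h" by (rule resolvent_unique[OF assms P])
  then show ?thesis using P[of h] by (simp add: algebra_simps)
qed

lemma resolvent_commute:
  assumes z: "cmod z = 1" and Y: "bounded_clinear Y" "\<And>x. Y (X x) = X (Y x)"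
  shows "R z (Y h) = Y (R z h)"
proof (rule resolvent_unique[OF z])
  have "Y (R z h) = Y (h + cnj z *\<^sub>C X (R z h))" by (rule arg_cong[OF resolvent_eq[OF z]])
  also have "\<dots> = Y h + cnj z *\<^sub>C X (Y (R z h))" by (simp add: bounded_clinearD[OF Y(1)] Y(2))
  finally show "Y (R z h) - cnj z *\<^sub>C X (Y (R z h)) = Y h" by (simp only: diff_eq_eq)
qed

lemma resolvent_bounded:
  obtains C where "C > 0" "\<And>z h. cmod z = 1 \<Longrightarrow> norm (R z h) \<le> C * norm h"
proof -
  obtain c where c: "c > 0" "\<And>z u. cmod z = 1 \<Longrightarrow> c * norm u \<le> norm (u - z *\<^sub>C X u)"
    using bounded_below by blast
  have "norm (R z h) \<le> 1 / c * norm h" if z: "cmod z = 1" for z h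
  proof -
    have "R z h - cnj z *\<^sub>C X (R z h) = h" using resolvent_eq[OF z, of h] by (simp add: algebra_simps)
    then have "c * norm (R z h) \<le> norm h" using c(2)[of "cnj z" "R z h"] z by simp
    then show ?thesis using c(1) by (simp add: field_simps)
  qed
  then show ?thesis using that[of "1 / c"] c(1) by simp
qed

text \<open>
  After the reflection \<open>z \<mapsto> cnj z\<close> the resolvent equation becomes \<open>d = z h + z X d\<close> for \<open>d = z R h\<close>,
  which Neumann iteration solves by polynomials.
\<close>

lemma resolvent_antianalytic: "analytic0 (\<lambda>z. z *\<^sub>C R (cnj z) h)"
proof -
  obtain C where C: "C > 0" "\<And>z h. cmod z = 1 \<Longrightarrow> norm (R z h) \<le> C * norm h"
    using resolvent_bounded by blast
  obtain e where e: "e > 0" "\<And>x. e * (norm x)\<^sup>2 \<le> Re (defect Q X x x)" using D.coercive by blast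
  have "powers_vanish X"
    by (rule Q.powers_vanish[OF e(1)]) (use e(2) in \<open>simp add: defect_def\<close>)
  then show ?thesis
  proof (rule analytic0_fixpoint[OF X _ analytic0_linear])
    fix z :: complex assume z: "cmod z = 1"
    have "z *\<^sub>C R (cnj z) h = z *\<^sub>C (h + cnj (cnj z) *\<^sub>C X (R (cnj z) h))"
      by (rule arg_cong[OF resolvent_eq]) (simp add: z)
    also have "\<dots> = z *\<^sub>C h + z *\<^sub>C X (z *\<^sub>C R (cnj z) h)"
      by (simp add: scaleC_add_right bounded_clinearD[OF X])
    finally show "z *\<^sub>C R (cnj z) h = z *\<^sub>C h + z *\<^sub>C X (z *\<^sub>C R (cnj z) h)" .
    show "norm (z *\<^sub>C R (cnj z) h) \<le> C * norm h"
      using C(2)[of "cnj z" h] z by (simp add: norm_scaleC)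
  qed
qed

lemma mean_zero_resolvent:
  assumes "bounded_sesquilinear b" "analytic0 f"
  shows "mean_zero (\<lambda>z. b (f z) (R z h))"
  by (rule bounded_sesquilinear.mean_zero_analytic0[OF assms resolvent_antianalytic])

text \<open>
  The embedding of \<open>h\<close> as the function \<open>z \<mapsto> R z h\<close> is isometric. Put \<open>u = R z h = h + v\<close> with \<open>v = cnj z X u\<close>. Since
  \<open>\<bar>z\<bar> = 1\<close>, the defect of \<open>u\<close> is \<open>Q(u, u) - Q(v, v) = Q(h, h) + Q(h, v) + Q(v, h)\<close>, and the last two
  terms have only frequencies of one sign.
\<close>

lemma mean_defect_resolvent: "mean_zero (\<lambda>z. defect Q X (R z h) (R z h) - Q h h)"
proof -
  let ?f = "\<lambda>z. Q (z *\<^sub>C h) (R z (X h))"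
  have f: "mean_zero ?f"
    by (rule mean_zero_resolvent[OF Q.bounded_sesquilinear_axioms analytic0_linear])
  show ?thesis
  proof (rule mean_zero_cong[OF mean_zero_add[OF f mean_zero_cnj[OF f]]])
    fix z :: complex assume z: "cmod z = 1"
    have X_R: "R z (X h) = X (R z h)" by (rule resolvent_commute[OF z X]) simp
    define u where "u = R z h"
    define v where "v = cnj z *\<^sub>C X u"
    have u: "u = h + v" using resolvent_eq[OF z, of h] by (simp add: u_def v_def)
    have "z * cnj z = 1" using complex_norm_square[of z] z by simp
    then have "Q (X u) (X u) = Q v v"
      by (simp add: v_def Q.scale_left Q.scale_right mult.assoc[symmetric] mult.commute)
    then have "defect Q X u u - Q h h = Q h v + Q v h"
      by (simp add: defect_def) (simp add: u Q.add_left Q.add_right)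
    moreover have "?f z = Q h v" by (simp add: X_R u_def v_def Q.scale_left Q.scale_right)
    ultimately show "defect Q X (R z h) (R z h) - Q h h = ?f z + cnj (?f z)"
      using Q.hermitian[of h v] by (simp add: u_def)
  qed
qed

text \<open>
  Up to functions orthogonal to all resolvents, \<open>V\<close> is represented on the circle by the fibrewise
  operators \<open>W z\<close>. Hence \<open>Q(V h, V h)\<close> is the mean of the defect form at \<open>W z (R z h)\<close> and \<open>R z (V h)\<close>.
  Estimating twice its real part by the sum of the two squares, and using \<open>mean_defect_resolvent\<close> for both,
  gives \<open>2 Q(V h, V h) \<le> C\<^sup>2 Q(h, h) + Q(V h, V h)\<close>.
\<close>

lemma transference:
  assumes W: "analytic0 (\<lambda>z. W z (R z h) - R z (V h))"
    and C: "\<And>z u. cmod z = 1 \<Longrightarrow>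
      Re (defect Q X (W z u) (W z u)) \<le> C\<^sup>2 * Re (defect Q X u u)"
  shows "Re (Q (V h) (V h)) \<le> C\<^sup>2 * Re (Q h h)"
proof -
  let ?D = "defect Q X"
  define f where "f z = ?D (W z (R z h) - R z (V h)) (R z (V h))" for z
  define F where "F z = of_real (C\<^sup>2) * ?D (R z h) (R z h) - ?D (R z (V h)) (R z (V h)) - 2 * f z" for z
  define c where "c = of_real (C\<^sup>2) * Q h h - Q (V h) (V h)"
  have "mean_zero f"
    unfolding f_def by (rule mean_zero_resolvent[OF D.bounded_sesquilinear_axioms W])
  then have "mean_zero (\<lambda>z. of_real (C\<^sup>2) * (?D (R z h) (R z h) - Q h h)
      + ((-1) * (?D (R z (V h)) (R z (V h)) - Q (V h) (V h)) + (-2) * f z))"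
    by (intro mean_zero_add mean_zero_scale mean_defect_resolvent)
  then have "mean_zero (\<lambda>z. F z - c)"
    by (rule mean_zero_cong) (simp add: F_def c_def algebra_simps)
  then have lim: "(\<lambda>N. circle_average N (\<lambda>z. F z - c)) \<longlonglongrightarrow> 0" by (simp add: mean_zero_def)
  \<comment> \<open>The mean of \<open>F\<close> is \<open>c\<close>, and its real part is nonnegative on the circle.\<close>
  have "Re (F z) \<ge> 0" if z: "cmod z = 1" for z
    using D.two_Re_le[of "W z (R z h)" "R z (V h)"] C[OF z, of "R z h"]
    by (simp add: F_def f_def D.diff_left)
  then have "0 \<le> Re (circle_average N F)" for N
    by (simp add: circle_average_def sum_nonneg)
  moreover have "circle_average N F = circle_average N (\<lambda>z. F z - c) + c" if "N > 0" for N
    using that by (simp add: circle_average_def sum_subtractf diff_divide_distrib)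
  ultimately have "0 \<le> Re (circle_average N (\<lambda>z. F z - c) + c)" if "N > 0" for N
    using that by metis
  moreover have "(\<lambda>N. Re (circle_average N (\<lambda>z. F z - c) + c)) \<longlonglongrightarrow> Re (0 + c)"
    by (intro tendsto_intros lim)
  ultimately have "0 \<le> Re (0 + c)"
    by (intro tendsto_lowerbound[of _ _ sequentially])
      (auto intro: eventually_mono[OF eventually_gt_at_top[of 0]])
  then show ?thesis by (simp add: c_def)
qed

text \<open>
  By the resolvent equation, \<open>X\<close> acts on the embedded functions as multiplication by \<open>z\<close> followed by removal
  of the positive frequencies, that is, as a backward shift.
\<close>

lemma resolvent_power: "analytic0 (\<lambda>z. z ^ a *\<^sub>C R z h - R z ((X ^^ a) h))"
proof (induction a)
  case 0
  then show ?case by (simp add: analytic0_zero)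
next
  case (Suc a)
  have "analytic0 (\<lambda>z. z *\<^sub>C (z ^ a *\<^sub>C R z h - R z ((X ^^ a) h)) + z *\<^sub>C (X ^^ a) h)"
    by (intro analytic0_add analytic0_shift Suc analytic0_linear)
  then show ?case
  proof (rule analytic0_cong)
    fix z :: complex assume z: "cmod z = 1"
    have "z *\<^sub>C R z ((X ^^ a) h) = z *\<^sub>C ((X ^^ a) h + cnj z *\<^sub>C X (R z ((X ^^ a) h)))"
      by (rule arg_cong[OF resolvent_eq[OF z]])
    moreover have "z * cnj z = 1" using complex_norm_square[of z] z by simp
    moreover have "R z (X ((X ^^ a) h)) = X (R z ((X ^^ a) h))"
      by (rule resolvent_commute[OF z X]) simp
    ultimately have "z *\<^sub>C R z ((X ^^ a) h) = z *\<^sub>C (X ^^ a) h + R z ((X ^^ Suc a) h)"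
      by (simp add: scaleC_add_right scaleC_scaleC)
    then show "z ^ Suc a *\<^sub>C R z h - R z ((X ^^ Suc a) h)
        = z *\<^sub>C (z ^ a *\<^sub>C R z h - R z ((X ^^ a) h)) + z *\<^sub>C (X ^^ a) h"
      by (simp add: scaleC_diff_right scaleC_scaleC)
  qed
qed

end

section \<open>The von Neumann inequality with respect to a form\<close>

lemma ordered_comp_empty [simp]: "ordered_comp T {} = id"
  by (simp add: ordered_comp_def)

lemma ordered_comp_insert:
  assumes "finite F" "j \<notin> F" "\<And>i. i \<in> F \<Longrightarrow> T j \<circ> T i = T i \<circ> T j"
  shows "ordered_comp T (insert j F) = T j \<circ> ordered_comp T F"
proof -
  have "foldr (\<circ>) (map T (insort j xs)) id = T j \<circ> foldr (\<circ>) (map T xs) id"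
    if "\<And>i. i \<in> set xs \<Longrightarrow> T j \<circ> T i = T i \<circ> T j" for xs
    using that by (induction xs) (auto simp: o_assoc)
  from this[of "sorted_list_of_set F"] show ?thesis
    using assms by (simp add: ordered_comp_def sorted_list_of_set_insert_remove)
qed

lemma ordered_comp_commute:
  assumes "finite F" "\<And>i. i \<in> F \<Longrightarrow> S \<circ> T i = T i \<circ> S"
  shows "ordered_comp T F \<circ> S = S \<circ> ordered_comp T F"
proof -
  have "foldr (\<circ>) (map T xs) id \<circ> S = S \<circ> foldr (\<circ>) (map T xs) id"
    if "\<And>i. i \<in> set xs \<Longrightarrow> S \<circ> T i = T i \<circ> S" for xs
    using that
  proof (induction xs)
    case (Cons i xs)
    have IH: "foldr (\<circ>) (map T xs) id \<circ> S = S \<circ> foldr (\<circ>) (map T xs) id"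
      by (rule Cons.IH, rule Cons.prems) simp
    have i: "S \<circ> T i = T i \<circ> S" by (rule Cons.prems) simp
    have "foldr (\<circ>) (map T (i # xs)) id = T i \<circ> foldr (\<circ>) (map T xs) id" by simp
    then show ?case by (metis i IH comp_assoc)
  qed simp
  from this[of "sorted_list_of_set F"] show ?thesis
    using assms by (simp add: ordered_comp_def)
qed

definition monomial_op :: "(nat \<Rightarrow> 'a \<Rightarrow> 'a) \<Rightarrow> nat set \<Rightarrow> (nat \<Rightarrow>\<^sub>0 nat) \<Rightarrow> 'a \<Rightarrow> 'a"
  where "monomial_op X F \<alpha> = ordered_comp (\<lambda>i. X i ^^ Poly_Mapping.lookup \<alpha> i) F"

text \<open>
  Contractivity refers to a form, and the form changes from step to step; it enters as coercivity of
  \<^const>\<open>defect\<close> instead.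
\<close>

definition commuting_family :: "(nat \<Rightarrow> 'a::complex_inner \<Rightarrow> 'a) \<Rightarrow> nat set \<Rightarrow> bool"
  where "commuting_family X F \<longleftrightarrow> finite F \<and> (\<forall>i\<in>F. bounded_clinear (X i)) \<and>
    (\<forall>i\<in>F. \<forall>j\<in>F. X i \<circ> X j = X j \<circ> X i)"

text \<open>
  The coefficients range over all of \<^typ>\<open>(nat \<Rightarrow>\<^sub>0 nat) \<Rightarrow> complex\<close> and are not tied to a polynomial in
  the variables in \<open>F\<close>. Freezing one variable at a point of the circle then only changes the
  coefficients, which is what the induction on \<open>F\<close> needs.
\<close>

definition von_neumann :: "('a::complex_inner \<Rightarrow> 'a \<Rightarrow> complex) \<Rightarrow> (nat \<Rightarrow> 'a \<Rightarrow> 'a) \<Rightarrow> nat set \<Rightarrow> bool"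
  where "von_neumann Q X F \<longleftrightarrow> (\<forall>A c C. finite A \<longrightarrow>
    (\<forall>z. (\<forall>i\<in>F. cmod (z i) = 1) \<longrightarrow>
      cmod (\<Sum>\<alpha>\<in>A. c \<alpha> * (\<Prod>i\<in>F. z i ^ Poly_Mapping.lookup \<alpha> i)) \<le> C) \<longrightarrow>
    (\<forall>h. Re (Q (\<Sum>\<alpha>\<in>A. c \<alpha> *\<^sub>C monomial_op X F \<alpha> h) (\<Sum>\<alpha>\<in>A. c \<alpha> *\<^sub>C monomial_op X F \<alpha> h))
      \<le> C\<^sup>2 * Re (Q h h)))"

lemma commuting_family_subset:
  "commuting_family X F \<Longrightarrow> G \<subseteq> F \<Longrightarrow> commuting_family X G"
  by (auto simp: commuting_family_def intro: finite_subset)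

lemma funpow_commute:
  assumes "f \<circ> g = g \<circ> f"
  shows "(f ^^ m) \<circ> (g ^^ n) = (g ^^ n) \<circ> (f ^^ m)"
proof -
  have "f \<circ> (g ^^ n) = (g ^^ n) \<circ> f" for n
    by (induction n) (use assms in \<open>auto simp: fun_eq_iff\<close>)
  then show ?thesis
    by (induction m) (auto simp: fun_eq_iff)
qed

lemma monomial_op_insert:
  assumes "commuting_family X (insert j F)" "j \<notin> F"
  shows "monomial_op X (insert j F) \<alpha> h
    = (X j ^^ Poly_Mapping.lookup \<alpha> j) (monomial_op X F \<alpha> h)"
proof -
  have "monomial_op X (insert j F) \<alpha>
      = (X j ^^ Poly_Mapping.lookup \<alpha> j) \<circ> monomial_op X F \<alpha>"
    unfolding monomial_op_def
    by (rule ordered_comp_insert)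
      (use assms in \<open>auto simp: commuting_family_def intro!: funpow_commute\<close>)
  then show ?thesis by simp
qed

lemma monomial_op_commute:
  assumes "commuting_family X (insert j F)"
  shows "monomial_op X F \<alpha> (X j h) = X j (monomial_op X F \<alpha> h)"
proof -
  have F: "finite F" "\<And>i. i \<in> F \<Longrightarrow> X j \<circ> X i = X i \<circ> X j"
    using assms unfolding commuting_family_def finite_insert by blast+
  have "X j ((X i ^^ n) x) = (X i ^^ n) (X j x)" if "i \<in> F" for i n x
    using fun_cong[OF funpow_commute[OF F(2)[OF that], of 1 n], of x] by simp
  then have "monomial_op X F \<alpha> \<circ> X j = X j \<circ> monomial_op X F \<alpha>"
    unfolding monomial_op_def by (intro ordered_comp_commute F(1)) (simp add: fun_eq_iff)
  then show ?thesis by (metis comp_apply)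
qed

lemma bounded_clinear_monomial_op:
  assumes "commuting_family X F"
  shows "bounded_clinear (monomial_op X F \<alpha>)"
proof -
  have "finite F" using assms by (simp add: commuting_family_def)
  then show ?thesis
    using assms
  proof (induction F)
    case empty
    then show ?case using bounded_clinear_id by (simp add: monomial_op_def id_def)
  next
    case (insert i F)
    have "monomial_op X (insert i F) \<alpha>
        = (\<lambda>x. (X i ^^ Poly_Mapping.lookup \<alpha> i) (monomial_op X F \<alpha> x))"
      by (rule ext) (rule monomial_op_insert[OF insert.prems insert.hyps(2)])
    moreover have "bounded_clinear (X i)" "commuting_family X F"
      using insert.prems by (auto simp: commuting_family_def)
    ultimately show ?case
      using bounded_clinear_compose[OF bounded_clinear_funpow insert.IH] by simp
  qed
qed

lemma von_neumannD:
  assumes "von_neumann Q X F" "finite A"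
    and "\<And>z. \<forall>i\<in>F. cmod (z i) = 1 \<Longrightarrow>
      cmod (\<Sum>\<alpha>\<in>A. c \<alpha> * (\<Prod>i\<in>F. z i ^ Poly_Mapping.lookup \<alpha> i)) \<le> C"
  shows "Re (Q (\<Sum>\<alpha>\<in>A. c \<alpha> *\<^sub>C monomial_op X F \<alpha> h) (\<Sum>\<alpha>\<in>A. c \<alpha> *\<^sub>C monomial_op X F \<alpha> h))
    \<le> C\<^sup>2 * Re (Q h h)"
  using assms unfolding von_neumann_def by blast

lemma von_neumann_empty:
  assumes "coercive_form Q"
  shows "von_neumann Q X {}"
  unfolding von_neumann_def
proof (intro allI impI)
  fix A :: "(nat \<Rightarrow>\<^sub>0 nat) set" and c C h
  interpret coercive_form Q by fact
  assume "\<forall>z::nat \<Rightarrow> complex. (\<forall>i\<in>{}. cmod (z i) = 1) \<longrightarrow>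
      cmod (\<Sum>\<alpha>\<in>A. c \<alpha> * (\<Prod>i\<in>{}. z i ^ Poly_Mapping.lookup \<alpha> i)) \<le> C"
  then have "cmod (\<Sum>\<alpha>\<in>A. c \<alpha>) \<le> C" by simp
  then have "(cmod (\<Sum>\<alpha>\<in>A. c \<alpha>))\<^sup>2 \<le> C\<^sup>2" by (rule power_mono) simp
  from mult_right_mono[OF this nonneg]
  show "Re (Q (\<Sum>\<alpha>\<in>A. c \<alpha> *\<^sub>C monomial_op X {} \<alpha> h) (\<Sum>\<alpha>\<in>A. c \<alpha> *\<^sub>C monomial_op X {} \<alpha> h))
      \<le> C\<^sup>2 * Re (Q h h)"
    by (simp add: monomial_op_def quadratic_scale flip: scaleC_sum_left)
qed

text \<open>
  Passing to the circle replaces \<open>X j\<close> by the scalar \<open>z\<close>, while the remaining operators commute with the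
  resolvent and stay as they are. Fibrewise, what is left is the inequality for the polynomial with
  its \<open>j\<close>-th variable frozen at \<open>z\<close>. With \<open>F = {}\<close> this is the inequality for one contraction.
\<close>

lemma von_neumann_insert:
  fixes Q :: "'a::chilbert_space \<Rightarrow> 'a \<Rightarrow> complex"
  assumes Q: "coercive_form Q" "coercive_form (defect Q (X j))"
    and cf: "commuting_family X (insert j F)" and j: "j \<notin> F"
    and vN: "von_neumann (defect Q (X j)) X F"
  shows "von_neumann Q X (insert j F)"
  unfolding von_neumann_def
proof (intro allI impI)
  fix A :: "(nat \<Rightarrow>\<^sub>0 nat) set" and c C h
  assume A: "finite A" and C: "\<forall>z::nat \<Rightarrow> complex. (\<forall>i\<in>insert j F. cmod (z i) = 1) \<longrightarrow>
      cmod (\<Sum>\<alpha>\<in>A. c \<alpha> * (\<Prod>i\<in>insert j F. z i ^ Poly_Mapping.lookup \<alpha> i)) \<le> C"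
  have Xj: "bounded_clinear (X j)" and F: "finite F" using cf by (auto simp: commuting_family_def)
  have cf': "commuting_family X F" using cf by (rule commuting_family_subset) auto
  interpret strict_contraction Q "X j"
    using Q Xj by (simp add: strict_contraction_def strict_contraction_axioms_def)
  define V where "V = (\<lambda>h. \<Sum>\<alpha>\<in>A. c \<alpha> *\<^sub>C monomial_op X (insert j F) \<alpha> h)"
  define W where "W z = (\<lambda>h. \<Sum>\<alpha>\<in>A. (c \<alpha> * z ^ Poly_Mapping.lookup \<alpha> j) *\<^sub>C monomial_op X F \<alpha> h)" for z
  have "analytic0 (\<lambda>z. \<Sum>\<alpha>\<in>A. c \<alpha> *\<^sub>C (z ^ Poly_Mapping.lookup \<alpha> j *\<^sub>C R z (monomial_op X F \<alpha> h)
      - R z ((X j ^^ Poly_Mapping.lookup \<alpha> j) (monomial_op X F \<alpha> h))))"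
    by (intro analytic0_sum analytic0_scaleC resolvent_power)
  then have "analytic0 (\<lambda>z. W z (R z h) - R z (V h))"
  proof (rule analytic0_cong)
    fix z :: complex assume z: "cmod z = 1"
    have "R z (monomial_op X F \<alpha> h) = monomial_op X F \<alpha> (R z h)" for \<alpha>
      by (rule resolvent_commute[OF z bounded_clinear_monomial_op[OF cf'] monomial_op_commute[OF cf]])
    then show "W z (R z h) - R z (V h) = (\<Sum>\<alpha>\<in>A. c \<alpha> *\<^sub>C
        (z ^ Poly_Mapping.lookup \<alpha> j *\<^sub>C R z (monomial_op X F \<alpha> h)
        - R z ((X j ^^ Poly_Mapping.lookup \<alpha> j) (monomial_op X F \<alpha> h))))"
      by (simp add: W_def V_def bounded_clinearD[OF resolvent_bounded_clinear[OF z]]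
          monomial_op_insert[OF cf j] scaleC_diff_right scaleC_scaleC sum_subtractf)
  qed
  moreover have "Re (defect Q (X j) (W z u) (W z u)) \<le> C\<^sup>2 * Re (defect Q (X j) u u)"
    if z: "cmod z = 1" for z u
  proof -
    have "cmod (\<Sum>\<alpha>\<in>A. (c \<alpha> * z ^ Poly_Mapping.lookup \<alpha> j) * (\<Prod>i\<in>F. w i ^ Poly_Mapping.lookup \<alpha> i)) \<le> C"
      if w: "\<forall>i\<in>F. cmod (w i) = 1" for w
    proof -
      have "(\<Prod>i\<in>F. (w(j := z)) i ^ Poly_Mapping.lookup \<alpha> i) = (\<Prod>i\<in>F. w i ^ Poly_Mapping.lookup \<alpha> i)" for \<alpha>
        by (rule prod.cong) (use j in auto)
      then show ?thesis
        using C[THEN spec, of "w(j := z)"] w z F j by (simp add: mult.assoc)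
    qed
    then show ?thesis
      using vN[unfolded von_neumann_def, rule_format, OF A, of "\<lambda>\<alpha>. c \<alpha> * z ^ Poly_Mapping.lookup \<alpha> j" C u]
      by (simp add: W_def)
  qed
  ultimately have "Re (Q (V h) (V h)) \<le> C\<^sup>2 * Re (Q h h)" by (rule transference)
  then show "Re (Q (\<Sum>\<alpha>\<in>A. c \<alpha> *\<^sub>C monomial_op X (insert j F) \<alpha> h)
      (\<Sum>\<alpha>\<in>A. c \<alpha> *\<^sub>C monomial_op X (insert j F) \<alpha> h)) \<le> C\<^sup>2 * Re (Q h h)"
    by (simp add: V_def)
qed

section \<open>Two commuting contractions\<close>

text \<open>
  Let \<open>A\<close> and \<open>B\<close> be the defect forms of \<open>X\<close> and \<open>Y\<close>. The identity
  \<open>A(h, h) + B(X h, X h) = B(h, h) + A(Y h, Y h)\<close>, which goes back to Ando, says that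
  \<open>(h, X h) \<mapsto> (Y h, h)\<close> is isometric for \<open>A \<oplus> B\<close>. Extended by zero to the orthogonal complement of the
  graph of \<open>X\<close>, it is a contraction, and feeding \<open>z\<close> times the second output back into the second input
  leaves a contraction \<open>transfer z\<close> of the first component. Under the passage to the circle determined by
  \<open>X\<close>, the operator \<open>Y\<close> becomes \<open>transfer z\<close>.
\<close>

locale commuting_strict_contractions = strict_contraction Q X + E: coercive_form "defect Q Y"
  for Q :: "'a::chilbert_space \<Rightarrow> 'a \<Rightarrow> complex" and X Y +
  assumes Y: "bounded_clinear Y" and XY: "X (Y x) = Y (X x)"
begin

abbreviation "A \<equiv> defect Q X"
abbreviation "B \<equiv> defect Q Y"

lemma exchange: "A x y + B (X x) (X y) = B x y + A (Y x) (Y y)"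
  by (simp add: defect_def XY)

lemma B_X_bounded: "bounded_sesquilinear (\<lambda>x y. B x (X y))"
  by (rule bounded_sesquilinear_compose[OF E.bounded_sesquilinear_axioms bounded_clinear_id X])

text \<open>
  The exchange identity bounds both \<open>B(x, x)\<close> and \<open>B(X x, X x)\<close>, the latter with \<open>A(x, x)\<close> to spare, by
  \<open>A(x, x) + B(X x, X x)\<close>.
\<close>

lemma pencil_coercive:
  obtains e where "e > 0"
    "\<And>z x. cmod z = 1 \<Longrightarrow> e * (norm x)\<^sup>2 \<le> Re (A x x + B (X x - z *\<^sub>C x) (X x))"
proof -
  obtain e where e: "e > 0" "\<And>x. e * (norm x)\<^sup>2 \<le> Re (A x x)" using D.coercive by blast
  have "e / 2 * (norm x)\<^sup>2 \<le> Re (A x x + B (X x - z *\<^sub>C x) (X x))" if z: "cmod z = 1" for z x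
  proof -
    have "Re (A x x) + Re (B (X x) (X x)) = Re (B x x) + Re (A (Y x) (Y x))"
      using arg_cong[OF exchange[of x x], of Re] by simp
    then show ?thesis
      using E.two_Re_le[of "z *\<^sub>C x" "X x"] e(2)[of x] D.nonneg[of "Y x"]
      by (simp add: E.diff_left E.quadratic_scale z)
  qed
  then show ?thesis using that[of "e / 2"] e(1) by simp
qed

lemma solution_exists:
  assumes z: "cmod z = 1"
  shows "\<exists>P. bounded_clinear P \<and> (\<forall>u k. A (P u) k + B (X (P u) - z *\<^sub>C P u) (X k) = A u k)"
proof -
  obtain e where e: "e > 0"
    "\<And>z x. cmod z = 1 \<Longrightarrow> e * (norm x)\<^sup>2 \<le> Re (A x x + B (X x - z *\<^sub>C x) (X x))"
    using pencil_coercive by blast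
  have "bounded_clinear (\<lambda>x. X x - z *\<^sub>C x)"
    by (intro bounded_clinear_diff bounded_clinear_scaleC bounded_clinear_id X)
  then have g: "bounded_sesquilinear (\<lambda>x y. A x y + B (X x - z *\<^sub>C x) (X y))"
    by (rule bounded_sesquilinear_add[OF D.bounded_sesquilinear_axioms
          bounded_sesquilinear_compose[OF E.bounded_sesquilinear_axioms _ X]])
  show ?thesis by (rule lax_milgram[OF g D.bounded_sesquilinear_axioms e(1) e(2)[OF z]])
qed

text \<open>
  With \<open>h = solution z u\<close>, the equation says that \<open>(u, z h)\<close> has the orthogonal projection \<open>(h, X h)\<close> onto
  the graph of \<open>X\<close>, so that \<open>h\<close> is the second output of the feedback loop and \<open>Y h\<close> the first.
\<close>

definition solution :: "complex \<Rightarrow> 'a \<Rightarrow> 'a"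
  where "solution z = (SOME P. bounded_clinear P \<and>
    (\<forall>u k. A (P u) k + B (X (P u) - z *\<^sub>C P u) (X k) = A u k))"

lemma solution:
  assumes "cmod z = 1"
  shows "bounded_clinear (solution z)"
    and "A (solution z u) k + B (X (solution z u) - z *\<^sub>C solution z u) (X k) = A u k"
  using someI_ex[OF solution_exists[OF assms]] by (auto simp: solution_def)

lemma solution_bounded:
  obtains C where "C > 0" "\<And>z u. cmod z = 1 \<Longrightarrow> norm (solution z u) \<le> C * norm u"
proof -
  obtain e where e: "e > 0"
    "\<And>z x. cmod z = 1 \<Longrightarrow> e * (norm x)\<^sup>2 \<le> Re (A x x + B (X x - z *\<^sub>C x) (X x))"
    using pencil_coercive by blast
  obtain K where K: "K > 0" "\<And>x y. cmod (A x y) \<le> K * norm x * norm y" using D.bound by blast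
  have "norm (solution z u) \<le> K / e * norm u" if z: "cmod z = 1" for z u
  proof (cases "solution z u = 0")
    case False
    define h where "h = solution z u"
    have "e * (norm h)\<^sup>2 \<le> Re (A h h + B (X h - z *\<^sub>C h) (X h))" by (rule e(2)[OF z])
    also have "\<dots> = Re (A u h)" using solution(2)[OF z, of u h] by (simp add: h_def)
    also have "\<dots> \<le> K * norm u * norm h" by (rule order_trans[OF complex_Re_le_cmod K(2)])
    finally show ?thesis using False e(1) by (simp add: power2_eq_square field_simps flip: h_def)
  qed (use K(1) e(1) in simp)
  then show ?thesis using that[of "K / e"] K(1) e(1) by simp
qed

definition transfer :: "complex \<Rightarrow> 'a \<Rightarrow> 'a"
  where "transfer z u = Y (solution z u)"

lemma bounded_clinear_transfer: "cmod z = 1 \<Longrightarrow> bounded_clinear (transfer z)"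
  unfolding transfer_def by (rule bounded_clinear_compose[OF Y solution(1)])

text \<open>
  The right-hand side is the squared distance from \<open>(u, z h)\<close> to its projection \<open>(h, X h)\<close> in \<open>A \<oplus> B\<close>,
  and the left-hand side is the energy lost in the loop.
\<close>

lemma transfer_defect:
  assumes z: "cmod z = 1"
  defines "h \<equiv> solution z"
  shows "Re (A u u) - Re (A (transfer z u) (transfer z u))
    = Re (A (u - h u) (u - h u)) + Re (B (X (h u) - z *\<^sub>C h u) (X (h u) - z *\<^sub>C h u))"
proof -
  let ?h = "h u"
  have "Re (A ?h ?h) + Re (B (X ?h) (X ?h)) = Re (B ?h ?h) + Re (A (Y ?h) (Y ?h))"
    using arg_cong[OF exchange[of ?h ?h], of Re] by simp
  moreover have "Re (A u ?h) = Re (A ?h ?h) + Re (B (X ?h) (X ?h)) - Re (B (z *\<^sub>C ?h) (X ?h))"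
    using arg_cong[OF solution(2)[OF z, of u ?h], of Re] by (simp add: h_def E.diff_left)
  ultimately show ?thesis
    using E.Re_commute[of "X ?h" "z *\<^sub>C ?h"]
    by (simp add: D.quadratic_diff E.quadratic_diff E.quadratic_scale z transfer_def flip: h_def)
qed

text \<open>
  If the distance in \<open>transfer_defect\<close> is small, then \<open>u\<close> is close to \<open>h\<close> and \<open>X h\<close> is close to \<open>z h\<close>.
  The latter forces \<open>h\<close> to be small, as \<open>X\<close> is a strict contraction.
\<close>

lemma coercive_form_transfer:
  assumes z: "cmod z = 1"
  shows "coercive_form (defect A (transfer z))"
proof -
  obtain e where e: "e > 0" "\<And>x. e * (norm x)\<^sup>2 \<le> Re (A x x)" using D.coercive by blast
  obtain d where d: "d > 0" "\<And>x. d * (norm x)\<^sup>2 \<le> Re (B x x)" using E.coercive by blast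
  obtain c where c: "c > 0" "\<And>z u. cmod z = 1 \<Longrightarrow> c * norm u \<le> norm (u - z *\<^sub>C X u)"
    using bounded_below by blast
  define m where "m = min e (d * c\<^sup>2)"
  have m: "m > 0" "m \<le> e" "m \<le> d * c\<^sup>2" using e d c by (auto simp: m_def)
  show ?thesis
  proof (rule coercive_form_defect[OF D.coercive_form_axioms bounded_clinear_transfer[OF z]])
    show "m / 2 > 0" using m by simp
    fix u
    define h where "h = solution z u"
    have zz: "z * cnj z = 1" using complex_norm_square[of z] z by simp
    have "X h - z *\<^sub>C h = - z *\<^sub>C (h - cnj z *\<^sub>C X h)"
      using zz by (simp add: scaleC_diff_right scaleC_scaleC scaleC_minus_left)
    then have "norm (X h - z *\<^sub>C h) = norm (h - cnj z *\<^sub>C X h)"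
      by (simp add: norm_scaleC z)
    then have "c * norm h \<le> norm (X h - z *\<^sub>C h)" using c(2)[of "cnj z" h] z by simp
    then have "(c * norm h)\<^sup>2 \<le> (norm (X h - z *\<^sub>C h))\<^sup>2"
      using c(1) by (intro power_mono) auto
    then have "d * (c * norm h)\<^sup>2 \<le> d * (norm (X h - z *\<^sub>C h))\<^sup>2"
      using d(1) by (intro mult_left_mono) auto
    then have 1: "d * c\<^sup>2 * (norm h)\<^sup>2 \<le> Re (B (X h - z *\<^sub>C h) (X h - z *\<^sub>C h))"
      using d(2)[of "X h - z *\<^sub>C h"] by (simp add: power_mult_distrib mult.assoc)
    have "m * (norm h)\<^sup>2 \<le> d * c\<^sup>2 * (norm h)\<^sup>2" "m * (norm (u - h))\<^sup>2 \<le> e * (norm (u - h))\<^sup>2"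
      using m by (auto intro: mult_right_mono)
    then have "m * ((norm (u - h))\<^sup>2 + (norm h)\<^sup>2) \<le> Re (A u u) - Re (A (transfer z u) (transfer z u))"
      using 1 e(2)[of "u - h"] transfer_defect[OF z, of u] unfolding distrib_left by (simp add: h_def)
    moreover have "(norm u)\<^sup>2 / 2 \<le> (norm (u - h))\<^sup>2 + (norm h)\<^sup>2"
    proof -
      have "norm u \<le> norm (u - h) + norm h" using norm_triangle_ineq[of "u - h" h] by simp
      then have "(norm u)\<^sup>2 \<le> (norm (u - h) + norm h)\<^sup>2" by (rule power_mono) simp
      also have "\<dots> \<le> 2 * ((norm (u - h))\<^sup>2 + (norm h)\<^sup>2)"
        using sum_squares_bound[of "norm (u - h)" "norm h"] by (simp add: power2_sum)
      finally show ?thesis by simp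
    qed
    then have "m * ((norm u)\<^sup>2 / 2) \<le> m * ((norm (u - h))\<^sup>2 + (norm h)\<^sup>2)"
      using m(1) by (intro mult_left_mono) auto
    ultimately show "m / 2 * (norm u)\<^sup>2 \<le> Re (A u u) - Re (A (transfer z u) (transfer z u))"
      by simp
  qed
qed

text \<open>
  This is the form \<open>A \<oplus> B\<close> restricted to the graph of \<open>X\<close>.
\<close>

definition graph_form :: "'a \<Rightarrow> 'a \<Rightarrow> complex"
  where "graph_form x y = A x y + B (X x) (X y)"

lemma coercive_form_graph_form: "coercive_form graph_form"
proof -
  obtain e where e: "e > 0" "\<And>x. e * (norm x)\<^sup>2 \<le> Re (A x x)" using D.coercive by blast
  interpret M: bounded_sesquilinear graph_form
    unfolding graph_form_def
    by (rule bounded_sesquilinear_add[OF D.bounded_sesquilinear_axioms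
          bounded_sesquilinear_compose[OF E.bounded_sesquilinear_axioms X X]])
  show ?thesis
  proof
    show "graph_form y x = cnj (graph_form x y)" for x y
      using D.hermitian[of x y] E.hermitian[of "X x" "X y"] by (simp add: graph_form_def)
    have "e * (norm x)\<^sup>2 \<le> Re (graph_form x x)" for x
      using e(2)[of x] E.nonneg[of "X x"] by (simp add: graph_form_def)
    then show "\<exists>e>0. \<forall>x. e * (norm x)\<^sup>2 \<le> Re (graph_form x x)" using e(1) by blast
  qed
qed

text \<open>
  \<open>K\<close> sends the second input to the second output. It is a strict contraction for \<open>B\<close>: the output \<open>K v\<close>
  satisfies \<open>B(K v, K v) + A(K v, K v) \<le> B(v, v)\<close>, and \<open>A\<close> dominates a multiple \<open>d\<close> of \<open>B\<close>.
\<close>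

lemma feedback_exists:
  "\<exists>K. bounded_clinear K \<and> powers_vanish K \<and> (\<forall>v k. graph_form (K v) k = B v (X k))"
proof -
  interpret M: coercive_form graph_form by (rule coercive_form_graph_form)
  obtain e where "e > 0" "\<And>x. e * (norm x)\<^sup>2 \<le> Re (graph_form x x)" using M.coercive by blast
  then obtain K where K: "bounded_clinear K" "\<And>v k. graph_form (K v) k = B v (X k)"
    using lax_milgram[OF M.bounded_sesquilinear_axioms B_X_bounded] by metis
  obtain a where a: "a > 0" "\<And>x. a * (norm x)\<^sup>2 \<le> Re (A x x)" using D.coercive by blast
  obtain b where b: "b > 0" "\<And>x. b * (norm x)\<^sup>2 \<le> Re (B x x)" using E.coercive by blast
  obtain L where L: "L > 0" "\<And>x y. cmod (B x y) \<le> L * norm x * norm y" using E.bound by blast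
  define d where "d = a / L"
  have d: "d > 0" using a L by (simp add: d_def)
  have "powers_vanish K"
  proof (rule E.powers_vanish)
    show "d / (1 + d) * b > 0" using d b(1) by simp
    fix v
    define x where "x = Re (B v v)"
    define y where "y = Re (B (K v) (K v))"
    have M1: "Re (graph_form (K v) (K v)) = Re (A (K v) (K v)) + Re (B (X (K v)) (X (K v)))"
      by (simp add: graph_form_def)
    have M2: "Re (graph_form (K v) (K v)) = y + Re (A (Y (K v)) (Y (K v)))"
      using arg_cong[OF exchange[of "K v" "K v"], of Re] by (simp add: graph_form_def y_def)
    have "y + Re (A (K v) (K v)) \<le> x"
      using E.two_Re_le[of v "X (K v)"] K(2)[of v "K v"] M1 M2 D.nonneg[of "Y (K v)"]
      by (simp add: x_def)
    moreover have "d * y \<le> Re (A (K v) (K v))"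
    proof -
      have "y \<le> L * norm (K v) * norm (K v)"
        unfolding y_def by (rule order_trans[OF complex_Re_le_cmod L(2)])
      then have "d * y \<le> d * (L * (norm (K v))\<^sup>2)"
        using d by (intro mult_left_mono) (auto simp: power2_eq_square mult.assoc)
      also have "\<dots> = a * (norm (K v))\<^sup>2" using L(1) by (simp add: d_def)
      finally show ?thesis using a(2)[of "K v"] by linarith
    qed
    ultimately have "d * x \<le> (1 + d) * (x - y)" by (simp add: algebra_simps)
    then have "d / (1 + d) * x \<le> x - y" using d by (simp add: field_simps)
    moreover have "d / (1 + d) * (b * (norm v)\<^sup>2) \<le> d / (1 + d) * x"
      using d b(2)[of v] by (intro mult_left_mono) (auto simp: x_def)
    ultimately show "d / (1 + d) * b * (norm v)\<^sup>2 \<le> Re (B v v) - Re (B (K v) (K v))"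
      by (simp add: x_def y_def mult.assoc)
  qed
  then show ?thesis using K by blast
qed

text \<open>
  The solution depends on \<open>z\<close> through the fixed-point equation \<open>h = J f + z K h\<close>, whose Neumann series
  is a power series in \<open>z\<close>.
\<close>

lemma analytic0_transfer:
  assumes f: "analytic0 f"
  shows "analytic0 (\<lambda>z. transfer z (f z))"
proof -
  interpret M: coercive_form graph_form by (rule coercive_form_graph_form)
  obtain K where K: "bounded_clinear K" "powers_vanish K" "\<And>v k. graph_form (K v) k = B v (X k)"
    using feedback_exists by blast
  obtain e where "e > 0" "\<And>x. e * (norm x)\<^sup>2 \<le> Re (graph_form x x)" using M.coercive by blast
  then obtain J where J: "bounded_clinear J" "\<And>v k. graph_form (J v) k = A v k"
    using lax_milgram[OF M.bounded_sesquilinear_axioms D.bounded_sesquilinear_axioms] by metis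
  obtain C where C: "C > 0" "\<And>z u. cmod z = 1 \<Longrightarrow> norm (solution z u) \<le> C * norm u"
    using solution_bounded by blast
  obtain S where S: "\<And>z. cmod z = 1 \<Longrightarrow> norm (f z) \<le> S" using analytic0_bounded[OF f] by metis
  have "analytic0 (\<lambda>z. solution z (f z))"
  proof (rule analytic0_fixpoint[OF K(1,2) analytic0_linear_image[OF J(1) f]])
    fix z :: complex assume z: "cmod z = 1"
    define h where "h = solution z (f z)"
    have "graph_form (h - (J (f z) + z *\<^sub>C K h)) k = 0" for k
      using solution(2)[OF z, of "f z" k]
      by (simp add: M.diff_left M.add_left M.scale_left J(2) K(3))
        (simp add: graph_form_def E.diff_left E.scale_left algebra_simps flip: h_def)
    then have "h - (J (f z) + z *\<^sub>C K h) = 0" by (rule M.eq_zeroI)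
    then show "solution z (f z) = J (f z) + z *\<^sub>C K (solution z (f z))" by (simp add: h_def)
    show "norm (solution z (f z)) \<le> C * S"
      by (rule order_trans[OF C(2)[OF z]]) (use S[OF z] C(1) in simp)
  qed
  then show ?thesis unfolding transfer_def by (rule analytic0_linear_image[OF Y])
qed

text \<open>
  On \<open>f = R z x\<close> one has \<open>z f - X f = z x\<close>, so that \<open>f\<close> solves the equation for \<open>solution z f\<close> up to
  an error of order \<open>z\<close>. The difference \<open>d\<close> satisfies \<open>d = z K x + z K d\<close> and so has only positive
  frequencies.
\<close>

lemma transfer_resolvent: "analytic0 (\<lambda>z. transfer z (R z x) - R z (Y x))"
proof -
  interpret M: coercive_form graph_form by (rule coercive_form_graph_form)
  obtain K where K: "bounded_clinear K" "powers_vanish K" "\<And>v k. graph_form (K v) k = B v (X k)"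
    using feedback_exists by blast
  obtain C where C: "C > 0" "\<And>z u. cmod z = 1 \<Longrightarrow> norm (solution z u) \<le> C * norm u"
    using solution_bounded by blast
  obtain S where S: "S > 0" "\<And>z h. cmod z = 1 \<Longrightarrow> norm (R z h) \<le> S * norm h"
    using resolvent_bounded by blast
  have g: "analytic0 (\<lambda>z. K (z *\<^sub>C x))" by (rule analytic0_linear_image[OF K(1) analytic0_linear])
  have "analytic0 (\<lambda>z. solution z (R z x) - R z x)"
  proof (rule analytic0_fixpoint[OF K(1,2) g])
    fix z :: complex assume z: "cmod z = 1"
    define f where "f = R z x"
    define h where "h = solution z f"
    \<comment> \<open>The residual of \<open>f\<close> in the equation for \<open>solution z f\<close> is \<open>- B (z x) (X k)\<close>.\<close>
    define d where "d = h - f"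
    have h: "h = d + f" by (simp add: d_def)
    have zz: "z * cnj z = 1" using complex_norm_square[of z] z by simp
    have "z *\<^sub>C f = z *\<^sub>C (x + cnj z *\<^sub>C X f)"
      unfolding f_def by (rule arg_cong[OF resolvent_eq[OF z]])
    then have Xf: "X f = z *\<^sub>C f - z *\<^sub>C x"
      using zz by (simp add: scaleC_add_right scaleC_scaleC)
    have "graph_form (d - (K (z *\<^sub>C x) + z *\<^sub>C K d)) k = 0" for k
    proof -
      have 1: "A h k + B (X h - z *\<^sub>C h) (X k) = A f k"
        using solution(2)[OF z, of f k] by (simp add: h_def)
      have 2: "X h - z *\<^sub>C h = X d - z *\<^sub>C d - z *\<^sub>C x"
        unfolding h by (simp add: bounded_clinearD[OF X] Xf scaleC_add_right)
      have "A (d + f) k + B (X d - z *\<^sub>C d - z *\<^sub>C x) (X k) = A f k"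
        using 1 unfolding 2 by (simp only: h[symmetric])
      then have "A d k + B (X d) (X k) = z * B d (X k) + z * B x (X k)"
        by (simp add: D.add_left E.add_left E.diff_left E.scale_left algebra_simps)
      then show ?thesis
        by (simp add: M.diff_left M.add_left M.scale_left K(3) E.scale_left) (simp add: graph_form_def)
    qed
    then have "d - (K (z *\<^sub>C x) + z *\<^sub>C K d) = 0" by (rule M.eq_zeroI)
    then show "solution z (R z x) - R z x = K (z *\<^sub>C x) + z *\<^sub>C K (solution z (R z x) - R z x)"
      by (simp add: d_def h_def f_def)
    have "norm h \<le> C * (S * norm x)"
      unfolding h_def by (rule order_trans[OF C(2)[OF z]]) (use S(2)[OF z] C(1) in \<open>simp add: f_def\<close>)
    then show "norm (solution z (R z x) - R z x) \<le> C * (S * norm x) + S * norm x"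
      using norm_triangle_ineq4[of h f] S(2)[OF z, of x] by (simp add: h_def f_def)
  qed
  from analytic0_linear_image[OF Y this] show ?thesis
  proof (rule analytic0_cong)
    fix z :: complex assume z: "cmod z = 1"
    show "transfer z (R z x) - R z (Y x) = Y (solution z (R z x) - R z x)"
      by (simp add: transfer_def bounded_clinearD[OF Y] resolvent_commute[OF z Y XY[symmetric]])
  qed
qed

lemma transfer_power_resolvent:
  "analytic0 (\<lambda>z. (transfer z ^^ b) (R z x) - R z ((Y ^^ b) x))"
proof (induction b)
  case 0
  then show ?case by (simp add: analytic0_zero)
next
  case (Suc b)
  have "analytic0 (\<lambda>z. transfer z ((transfer z ^^ b) (R z x) - R z ((Y ^^ b) x))
      + (transfer z (R z ((Y ^^ b) x)) - R z (Y ((Y ^^ b) x))))"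
    by (intro analytic0_add analytic0_transfer Suc transfer_resolvent)
  then show ?case
    by (rule analytic0_cong) (simp add: bounded_clinearD[OF bounded_clinear_transfer])
qed

end

text \<open>
  This is Ando's inequality for two strict contractions. On the fibre over \<open>z\<close> the pair becomes the
  scalar \<open>z\<close> together with the single contraction \<open>transfer z\<close>, and for one contraction the inequality
  is known.
\<close>

lemma von_neumann_pair:
  fixes Q :: "'a::chilbert_space \<Rightarrow> 'a \<Rightarrow> complex"
  assumes Q: "coercive_form Q" "coercive_form (defect Q (X i))" "coercive_form (defect Q (X j))"
    and cf: "commuting_family X {i, j}" and ij: "i \<noteq> j"
  shows "von_neumann Q X {i, j}"
  unfolding von_neumann_def
proof (intro allI impI)
  fix S :: "(nat \<Rightarrow>\<^sub>0 nat) set" and c C h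
  assume S: "finite S" and C: "\<forall>z::nat \<Rightarrow> complex. (\<forall>i\<in>{i, j}. cmod (z i) = 1) \<longrightarrow>
      cmod (\<Sum>\<alpha>\<in>S. c \<alpha> * (\<Prod>i\<in>{i, j}. z i ^ Poly_Mapping.lookup \<alpha> i)) \<le> C"
  have X: "bounded_clinear (X i)" "bounded_clinear (X j)" and "X i \<circ> X j = X j \<circ> X i"
    using cf unfolding commuting_family_def by blast+
  then have comm: "X i (X j x) = X j (X i x)" for x by (metis comp_apply)
  interpret commuting_strict_contractions Q "X i" "X j"
    using Q X comm
    by (simp add: commuting_strict_contractions_def commuting_strict_contractions_axioms_def
        strict_contraction_def strict_contraction_axioms_def)
  have mono: "monomial_op X {i, j} \<alpha> h
      = (X i ^^ Poly_Mapping.lookup \<alpha> i) ((X j ^^ Poly_Mapping.lookup \<alpha> j) h)" for \<alpha> h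
  proof -
    have "commuting_family X {j}" using cf by (rule commuting_family_subset) simp
    then have "monomial_op X {j} \<alpha> h = (X j ^^ Poly_Mapping.lookup \<alpha> j) h"
      using monomial_op_insert[of X j "{}" \<alpha> h] by (simp add: monomial_op_def)
    then show ?thesis using monomial_op_insert[OF cf] ij by simp
  qed
  define V where "V = (\<lambda>h. \<Sum>\<alpha>\<in>S. c \<alpha> *\<^sub>C monomial_op X {i, j} \<alpha> h)"
  define W where "W z = (\<lambda>h. \<Sum>\<alpha>\<in>S. (c \<alpha> * z ^ Poly_Mapping.lookup \<alpha> i) *\<^sub>C
      (transfer z ^^ Poly_Mapping.lookup \<alpha> j) h)" for z
  have "analytic0 (\<lambda>z. \<Sum>\<alpha>\<in>S. c \<alpha> *\<^sub>C (z ^ Poly_Mapping.lookup \<alpha> i *\<^sub>C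
        ((transfer z ^^ Poly_Mapping.lookup \<alpha> j) (R z h) - R z ((X j ^^ Poly_Mapping.lookup \<alpha> j) h))
      + (z ^ Poly_Mapping.lookup \<alpha> i *\<^sub>C R z ((X j ^^ Poly_Mapping.lookup \<alpha> j) h)
        - R z ((X i ^^ Poly_Mapping.lookup \<alpha> i) ((X j ^^ Poly_Mapping.lookup \<alpha> j) h)))))"
    by (intro analytic0_sum analytic0_scaleC analytic0_add analytic0_power_mult
        transfer_power_resolvent resolvent_power)
  then have "analytic0 (\<lambda>z. W z (R z h) - R z (V h))"
    by (rule analytic0_cong)
      (simp add: W_def V_def mono bounded_clinearD[OF resolvent_bounded_clinear]
        scaleC_diff_right scaleC_add_right scaleC_scaleC sum_subtractf)
  moreover have "Re (A (W z u) (W z u)) \<le> C\<^sup>2 * Re (A u u)" if z: "cmod z = 1" for z u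
  proof -
    have cfz: "commuting_family (\<lambda>_. transfer z) {j}"
      using bounded_clinear_transfer[OF z] by (simp add: commuting_family_def)
    have vN: "von_neumann A (\<lambda>_. transfer z) {j}"
      by (rule von_neumann_insert[OF _ _ _ _ von_neumann_empty])
        (use cfz coercive_form_transfer[OF z] D.coercive_form_axioms in auto)
    have bd: "cmod (\<Sum>\<alpha>\<in>S. (c \<alpha> * z ^ Poly_Mapping.lookup \<alpha> i) * (\<Prod>k\<in>{j}. w k ^ Poly_Mapping.lookup \<alpha> k)) \<le> C"
      if "\<forall>k\<in>{j}. cmod (w k) = 1" for w
      using C[THEN spec, of "w(i := z)"] that z ij by (simp add: mult.assoc)
    have "monomial_op (\<lambda>_. transfer z) {j} \<alpha> u = (transfer z ^^ Poly_Mapping.lookup \<alpha> j) u" for \<alpha>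
      using monomial_op_insert[OF cfz, of \<alpha> u] by (simp add: monomial_op_def)
    then show ?thesis
      using von_neumannD[OF vN S bd, where h = u] by (simp add: W_def)
  qed
  ultimately have "Re (Q (V h) (V h)) \<le> C\<^sup>2 * Re (Q h h)" by (rule transference)
  then show "Re (Q (\<Sum>\<alpha>\<in>S. c \<alpha> *\<^sub>C monomial_op X {i, j} \<alpha> h)
      (\<Sum>\<alpha>\<in>S. c \<alpha> *\<^sub>C monomial_op X {i, j} \<alpha> h)) \<le> C\<^sup>2 * Re (Q h h)"
    by (simp add: V_def)
qed

section \<open>Adjoint tuples\<close>

lemma bounded_clinear_cadjoint:
  fixes A :: "'a::chilbert_space \<Rightarrow> 'a"
  assumes A: "bounded_clinear A"
  shows "bounded_clinear (cadjoint A)"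
proof -
  obtain K where K: "K > 0" "\<And>x. norm (A x) \<le> K * norm x" using bounded_clinear_bound[OF A] by blast
  show ?thesis
  proof (rule bounded_clinearI)
    show "cadjoint A (x + y) = cadjoint A x + cadjoint A y" for x y
      by (rule cinner_right_unique) (simp add: cinner_add_right flip: cadjoint[OF A])
    show "cadjoint A (c *\<^sub>C x) = c *\<^sub>C cadjoint A x" for c x
      by (rule cinner_right_unique) (simp add: cinner_scaleC_right flip: cadjoint[OF A])
    show "norm (cadjoint A y) \<le> norm y * K" for y
    proof (cases "cadjoint A y = 0")
      case False
      have "(norm (cadjoint A y))\<^sup>2 = cmod (cinner (cadjoint A y) (cadjoint A y))"
        by (simp add: cinner_self flip: of_real_power)
      also have "\<dots> = cmod (cinner (A (cadjoint A y)) y)" by (simp add: cadjoint[OF A])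
      also have "\<dots> \<le> norm (A (cadjoint A y)) * norm y" by (rule norm_cinner_le)
      also have "\<dots> \<le> K * norm (cadjoint A y) * norm y" by (intro mult_right_mono K) simp
      finally show ?thesis using False by (simp add: power2_eq_square mult_ac)
    qed (use K in simp)
  qed
qed

lemma cadjoint_unique:
  fixes A :: "'a::chilbert_space \<Rightarrow> 'a"
  assumes A: "bounded_clinear A" and B: "\<And>x y. cinner (A x) y = cinner x (B y)"
  shows "cadjoint A = B"
  by (rule ext, rule cinner_right_unique) (simp add: B flip: cadjoint[OF A])

lemma bounded_clinear_ordered_comp:
  fixes T :: "nat \<Rightarrow> 'a::complex_inner \<Rightarrow> 'a"
  assumes "finite F" "\<And>i. i \<in> F \<Longrightarrow> bounded_clinear (T i)"
  shows "bounded_clinear (ordered_comp T F)"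
proof -
  have id: "bounded_clinear (id :: 'a \<Rightarrow> 'a)" using bounded_clinear_id by (simp add: id_def)
  have "bounded_clinear (foldr (\<circ>) (map T xs) id)" if "\<And>i. i \<in> set xs \<Longrightarrow> bounded_clinear (T i)" for xs
    using that
  proof (induction xs)
    case (Cons i xs)
    have "bounded_clinear (foldr (\<circ>) (map T xs) id)" by (rule Cons.IH, rule Cons.prems) simp
    moreover have "bounded_clinear (T i)" by (rule Cons.prems) simp
    moreover have "foldr (\<circ>) (map T (i # xs)) id = (\<lambda>x. T i (foldr (\<circ>) (map T xs) id x))"
      by (rule ext) simp
    ultimately show ?case by (simp only: bounded_clinear_compose)
  qed (simp add: id)
  from this[of "sorted_list_of_set F"] show ?thesis
    using assms by (simp add: ordered_comp_def)
qed

lemma cinner_ordered_comp: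
  assumes F: "finite F" and adj: "\<And>i x y. i \<in> F \<Longrightarrow> cinner (A i x) y = cinner x (B i y)"
    and A: "\<And>i j. i \<in> F \<Longrightarrow> j \<in> F \<Longrightarrow> A i \<circ> A j = A j \<circ> A i"
    and B: "\<And>i j. i \<in> F \<Longrightarrow> j \<in> F \<Longrightarrow> B i \<circ> B j = B j \<circ> B i"
  shows "cinner (ordered_comp A F x) y = cinner x (ordered_comp B F y)"
  using assms
proof (induction F arbitrary: y)
  case (insert j F)
  have "ordered_comp A (insert j F) = A j \<circ> ordered_comp A F"
    by (rule ordered_comp_insert[OF insert.hyps], rule insert.prems(2)) simp_all
  moreover have "ordered_comp B (insert j F) = B j \<circ> ordered_comp B F"
    by (rule ordered_comp_insert[OF insert.hyps], rule insert.prems(3)) simp_all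
  moreover have "ordered_comp B F \<circ> B j = B j \<circ> ordered_comp B F"
    by (rule ordered_comp_commute[OF insert.hyps(1)], rule insert.prems(3)) simp_all
  moreover have "cinner (ordered_comp A F x) z = cinner x (ordered_comp B F z)" for z
    by (rule insert.IH; rule insert.prems; simp)
  moreover have "cinner (A j u) v = cinner u (B j v)" for u v by (rule insert.prems(1)) simp
  ultimately show ?case by (metis comp_apply)
qed simp

lemma cadjoint_commute:
  fixes A B :: "'a::chilbert_space \<Rightarrow> 'a"
  assumes "bounded_clinear A" "bounded_clinear B" "A \<circ> B = B \<circ> A"
  shows "cadjoint A \<circ> cadjoint B = cadjoint B \<circ> cadjoint A"
proof -
  have "cinner x (cadjoint A (cadjoint B y)) = cinner x (cadjoint B (cadjoint A y))" for x y
    using fun_cong[OF assms(3), of x]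
    by (simp flip: cadjoint[OF assms(1)] cadjoint[OF assms(2)])
  then show ?thesis by (auto simp: fun_eq_iff intro: cinner_right_unique)
qed

lemma ordered_comp_reindex:
  assumes "finite F" "inj_on f F" "\<And>i j. i \<in> F \<Longrightarrow> j \<in> F \<Longrightarrow> T (f i) \<circ> T (f j) = T (f j) \<circ> T (f i)"
  shows "ordered_comp (\<lambda>i. T (f i)) F = ordered_comp T (f ` F)"
  using assms
proof (induction F)
  case (insert j F)
  have "ordered_comp (\<lambda>i. T (f i)) (insert j F) = T (f j) \<circ> ordered_comp (\<lambda>i. T (f i)) F"
    by (rule ordered_comp_insert[OF insert.hyps], rule insert.prems(2)) simp_all
  also have "ordered_comp (\<lambda>i. T (f i)) F = ordered_comp T (f ` F)"
  proof (rule insert.IH)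
    show "inj_on f F" by (rule inj_on_subset[OF insert.prems(1)]) auto
  qed (rule insert.prems(2); simp)
  also have "T (f j) \<circ> ordered_comp T (f ` F) = ordered_comp T (insert (f j) (f ` F))"
  proof (rule ordered_comp_insert[symmetric])
    show "f j \<notin> f ` F" using insert.prems(1) insert.hyps(2) by auto
    show "T (f j) \<circ> T i = T i \<circ> T (f j)" if "i \<in> f ` F" for i
    proof -
      obtain k where k: "k \<in> F" "i = f k" using \<open>i \<in> f ` F\<close> by blast
      show ?thesis unfolding k(2) by (rule insert.prems(2)) (use k(1) in simp_all)
    qed
  qed (use insert.hyps in simp)
  finally show ?case by simp
qed simp

lemma adjoint_family:
  assumes "T \<in> commuting_contractions n"
  shows "commuting_family (\<lambda>i. cadjoint (T i)) {1..n}"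
  unfolding commuting_family_def
proof (intro conjI ballI)
  have T: "bounded_clinear (T i)" "T i \<circ> T j = T j \<circ> T i" if "i \<in> {1..n}" "j \<in> {1..n}" for i j
    using assms that unfolding commuting_contractions_def by blast+
  show "bounded_clinear (cadjoint (T i))" if "i \<in> {1..n}" for i
    by (rule bounded_clinear_cadjoint[OF T(1)[OF that that]])
  show "cadjoint (T i) \<circ> cadjoint (T j) = cadjoint (T j) \<circ> cadjoint (T i)"
    if "i \<in> {1..n}" "j \<in> {1..n}" for i j
    by (rule cadjoint_commute[OF T(1)[OF that] T(1)[OF that(2,1)] T(2)[OF that]])
qed simp

lemma adjoint_ordered_comp:
  assumes T: "T \<in> commuting_contractions n" and F: "F \<subseteq> {1..n}"
  shows "cinner (ordered_comp T F x) y = cinner x (ordered_comp (\<lambda>i. cadjoint (T i)) F y)"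
proof (rule cinner_ordered_comp)
  show "finite F" using F by (rule finite_subset) simp
  show "cinner (T i x) y = cinner x (cadjoint (T i) y)" if "i \<in> F" for i x y
    using that T F by (intro cadjoint) (auto simp: commuting_contractions_def)
  show "T i \<circ> T j = T j \<circ> T i" if "i \<in> F" "j \<in> F" for i j
    using that T F unfolding commuting_contractions_def by blast
  show "cadjoint (T i) \<circ> cadjoint (T j) = cadjoint (T j) \<circ> cadjoint (T i)" if "i \<in> F" "j \<in> F" for i j
    using that adjoint_family[OF T] F unfolding commuting_family_def by blast
qed

text \<open>
  The map \<open>f\<close> below lists the indices other than \<open>r\<close> in increasing order, so that deleting the entry \<open>r\<close>
  is reindexing along \<open>f\<close>. Moving one factor \<open>T\<^sub>F\<close> to the other side of the inner product turns the
  Brehmer sum into an alternating sum of squares.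
\<close>

lemma brehmer_delete_entry:
  assumes T: "T \<in> commuting_contractions n" and B: "delete_entry r T \<in> brehmer (n - 1)"
    and r: "1 \<le> r" "r \<le> n" and G: "G \<subseteq> {1..n} - {r}"
  shows "0 \<le> (\<Sum>F\<in>Pow G. (-1) ^ card F * (norm (ordered_comp (\<lambda>i. cadjoint (T i)) F x))\<^sup>2)"
proof -
  define f where "f j = (if j < r then j else Suc j)" for j
  define G' where "G' = {j \<in> {1..n - 1}. f j \<in> G}"
  have del: "delete_entry r T = (\<lambda>j. T (f j))" by (auto simp: delete_entry_def f_def)
  have inj: "inj_on f A" for A by (auto simp: inj_on_def f_def split: if_splits)
  have "f ` G' = G"
  proof
    show "G \<subseteq> f ` G'"
    proof
      fix i assume i: "i \<in> G"
      then have "i \<in> {1..n}" "i \<noteq> r" using G by auto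
      define k where "k = (if i < r then i else i - 1)"
      have k: "f k = i" "k \<in> {1..n - 1}"
        using \<open>i \<in> {1..n}\<close> \<open>i \<noteq> r\<close> r by (auto simp: f_def k_def)
      then have "k \<in> G'" using i by (simp add: G'_def)
      then show "i \<in> f ` G'" using k(1) by blast
    qed
  qed (auto simp: G'_def)
  then have bij: "bij_betw f G' G" using inj by (simp add: bij_betw_def)
  have comp: "ordered_comp (delete_entry r T) F = ordered_comp T (f ` F)"
    and adj: "cadjoint (ordered_comp T (f ` F)) = ordered_comp (\<lambda>i. cadjoint (T i)) (f ` F)"
    and fin: "finite F" if F: "F \<in> Pow G'" for F
  proof -
    have sub: "f ` F \<subseteq> {1..n}" using F G by (auto simp: G'_def)
    show fin: "finite F" using F by (auto simp: G'_def intro: finite_subset)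
    show "ordered_comp (delete_entry r T) F = ordered_comp T (f ` F)"
      unfolding del
    proof (rule ordered_comp_reindex[OF fin inj])
      fix i j assume "i \<in> F" "j \<in> F"
      then have "f i \<in> {1..n}" "f j \<in> {1..n}" using sub by auto
      then show "T (f i) \<circ> T (f j) = T (f j) \<circ> T (f i)"
        using T unfolding commuting_contractions_def by blast
    qed
    show "cadjoint (ordered_comp T (f ` F)) = ordered_comp (\<lambda>i. cadjoint (T i)) (f ` F)"
    proof (rule cadjoint_unique[OF _ adjoint_ordered_comp[OF T sub]])
      show "bounded_clinear (ordered_comp T (f ` F))"
        by (rule bounded_clinear_ordered_comp)
          (use fin T sub in \<open>auto simp: commuting_contractions_def\<close>)
    qed
  qed
  have "G' \<subseteq> {1..n - 1}" by (auto simp: G'_def)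
  then have "cinner (\<Sum>F\<in>Pow G'. (-1) ^ card F *\<^sub>R ordered_comp (delete_entry r T) F
      (cadjoint (ordered_comp (delete_entry r T) F) x)) x \<in> \<real>\<^sub>\<ge>\<^sub>0"
    using B unfolding brehmer_def positive_op_def by blast
  then have "0 \<le> Re (cinner (\<Sum>F\<in>Pow G'. (-1) ^ card F *\<^sub>R ordered_comp (delete_entry r T) F
      (cadjoint (ordered_comp (delete_entry r T) F) x)) x)"
    by (simp add: complex_nonneg_Reals_iff)
  also have "\<dots> = (\<Sum>F\<in>Pow G'. (-1) ^ card F * inner (ordered_comp T (f ` F)
      (ordered_comp (\<lambda>i. cadjoint (T i)) (f ` F) x)) x)"
    unfolding Re_cinner inner_sum_left inner_scaleR_left by (rule sum.cong) (simp_all add: comp adj)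
  also have "\<dots> = (\<Sum>F\<in>Pow G'. (-1) ^ card (f ` F) *
      (norm (ordered_comp (\<lambda>i. cadjoint (T i)) (f ` F) x))\<^sup>2)"
  proof (rule sum.cong)
    fix F assume F: "F \<in> Pow G'"
    have sub: "f ` F \<subseteq> {1..n}" using F G by (auto simp: G'_def)
    show "(-1) ^ card F * inner (ordered_comp T (f ` F) (ordered_comp (\<lambda>i. cadjoint (T i)) (f ` F) x)) x
        = (-1) ^ card (f ` F) * (norm (ordered_comp (\<lambda>i. cadjoint (T i)) (f ` F) x))\<^sup>2"
      using arg_cong[OF adjoint_ordered_comp[OF T sub, of "ordered_comp (\<lambda>i. cadjoint (T i)) (f ` F) x" x], of Re]
      by (simp add: card_image[OF inj] Re_cinner power2_norm_eq_inner)
  qed simp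
  also have "\<dots> = (\<Sum>F\<in>Pow G. (-1) ^ card F * (norm (ordered_comp (\<lambda>i. cadjoint (T i)) F x))\<^sup>2)"
    using sum.reindex_bij_betw[OF bij_betw_Pow[OF bij],
        of "\<lambda>F. (-1) ^ card F * (norm (ordered_comp (\<lambda>i. cadjoint (T i)) F x))\<^sup>2"] .
  finally show ?thesis .
qed

section \<open>Brehmer forms of the scaled tuple\<close>

definition brehmer_form :: "(nat \<Rightarrow> 'a::complex_inner \<Rightarrow> 'a) \<Rightarrow> nat set \<Rightarrow> 'a \<Rightarrow> 'a \<Rightarrow> complex"
  where "brehmer_form X G x y
    = (\<Sum>F\<in>Pow G. (-1) ^ card F * cinner (ordered_comp X F x) (ordered_comp X F y))"

lemma sum_Pow_insert:
  fixes f :: "'b set \<Rightarrow> 'c::comm_monoid_add"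
  assumes "finite G" "j \<notin> G"
  shows "(\<Sum>F\<in>Pow (insert j G). f F) = (\<Sum>F\<in>Pow G. f F) + (\<Sum>F\<in>Pow G. f (insert j F))"
proof -
  have "inj_on (insert j) (Pow G)" using assms(2) by (auto simp: inj_on_def)
  moreover have "Pow G \<inter> insert j ` Pow G = {}" using assms(2) by auto
  ultimately show ?thesis
    using assms(1) by (simp add: Pow_insert sum.union_disjoint sum.reindex)
qed

text \<open>
  The subsets of \<open>insert j G\<close> containing \<open>j\<close> contribute the form of \<open>G\<close> at \<open>X j x\<close> and \<open>X j y\<close> with the
  opposite sign.
\<close>

lemma brehmer_form_insert:
  assumes cf: "commuting_family X (insert j G)" and j: "j \<notin> G"
  shows "brehmer_form X (insert j G) = defect (brehmer_form X G) (X j)"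
proof (intro ext)
  fix x y
  have G: "finite G" and comm: "\<And>i. i \<in> G \<Longrightarrow> X j \<circ> X i = X i \<circ> X j"
    using cf unfolding commuting_family_def finite_insert by blast+
  have ins: "ordered_comp X (insert j F) x = ordered_comp X F (X j x)" if F: "F \<in> Pow G" for F x
  proof -
    have fin: "finite F" using F G by (auto intro: finite_subset)
    have "ordered_comp X (insert j F) = X j \<circ> ordered_comp X F"
      by (rule ordered_comp_insert[OF fin]) (use F j comm in auto)
    also have "\<dots> = ordered_comp X F \<circ> X j"
      by (rule ordered_comp_commute[OF fin, symmetric]) (use F comm in auto)
    finally show ?thesis by simp
  qed
  have "(\<Sum>F\<in>Pow G. (-1) ^ card (insert j F) *
        cinner (ordered_comp X (insert j F) x) (ordered_comp X (insert j F) y))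
      = (\<Sum>F\<in>Pow G. - ((-1) ^ card F * cinner (ordered_comp X F (X j x)) (ordered_comp X F (X j y))))"
  proof (rule sum.cong)
    fix F assume F: "F \<in> Pow G"
    then have "card (insert j F) = Suc (card F)"
      using j G by (subst card_insert_disjoint) (auto intro: finite_subset)
    then show "(-1) ^ card (insert j F) *
          cinner (ordered_comp X (insert j F) x) (ordered_comp X (insert j F) y)
        = - ((-1) ^ card F * cinner (ordered_comp X F (X j x)) (ordered_comp X F (X j y)))"
      by (simp add: ins[OF F])
  qed simp
  then show "brehmer_form X (insert j G) x y = defect (brehmer_form X G) (X j) x y"
    by (simp add: brehmer_form_def sum_Pow_insert[OF G j] defect_def sum_negf)
qed

text \<open>
  Let \<open>\<sigma>\<^sub>i\<close> shift \<open>a\<close> by adjoining \<open>i\<close> to its argument. Writing \<open>1 - t \<sigma>\<^sub>i = (1 - t) + t (1 - \<sigma>\<^sub>i)\<close> in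
  each factor of \<open>\<Prod>(1 - t \<sigma>\<^sub>i)\<close> and expanding gives a combination of the products of the \<open>1 - \<sigma>\<^sub>i\<close>
  with nonnegative coefficients, in which the empty product has coefficient \<open>(1 - t) ^ card G\<close>.
\<close>

lemma alternating_sum_scaled:
  fixes a :: "'b set \<Rightarrow> real"
  assumes t: "0 \<le> t" "t \<le> 1" and G: "finite G"
    and pos: "\<And>H. H \<subseteq> G \<Longrightarrow> 0 \<le> (\<Sum>F\<in>Pow H. (-1) ^ card F * a F)"
  shows "(1 - t) ^ card G * a {} \<le> (\<Sum>F\<in>Pow G. (- t) ^ card F * a F)"
  using G pos
proof (induction G arbitrary: a)
  case (insert j G)
  have card: "card (insert j F) = Suc (card F)" if "F \<in> Pow H" "H \<subseteq> G" for F H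
    using that insert.hyps by (subst card_insert_disjoint) (auto intro: finite_subset)
  have split: "(\<Sum>F\<in>Pow (insert j H). s ^ card F * a F)
      = (\<Sum>F\<in>Pow H. s ^ card F * a F) + s * (\<Sum>F\<in>Pow H. s ^ card F * a (insert j F))"
    if H: "H \<subseteq> G" for s :: real and H
  proof -
    have "finite H" "j \<notin> H" using H insert.hyps by (auto intro: finite_subset)
    moreover have "(\<Sum>F\<in>Pow H. s ^ card (insert j F) * a (insert j F))
        = s * (\<Sum>F\<in>Pow H. s ^ card F * a (insert j F))"
      unfolding sum_distrib_left by (rule sum.cong) (use card H in \<open>auto simp: mult.assoc\<close>)
    ultimately show ?thesis by (simp add: sum_Pow_insert)
  qed
  let ?D = "\<lambda>a. \<Sum>F\<in>Pow G. (- t) ^ card F * a F"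
  define b where "b F = a F - a (insert j F)" for F
  have "(1 - t) ^ card G * a {} \<le> ?D a"
    by (rule insert.IH) (use insert.prems in auto)
  moreover have "(1 - t) ^ card G * b {} \<le> ?D b"
  proof (rule insert.IH)
    fix H assume H: "H \<subseteq> G"
    have "0 \<le> (\<Sum>F\<in>Pow (insert j H). (-1) ^ card F * a F)"
      by (rule insert.prems) (use H in auto)
    then show "0 \<le> (\<Sum>F\<in>Pow H. (-1) ^ card F * b F)"
      unfolding split[OF H] by (simp add: b_def right_diff_distrib sum_subtractf)
  qed
  moreover have "0 \<le> b {}"
    using insert.prems[of "{j}"] by (simp add: Pow_insert b_def)
  then have "0 \<le> (1 - t) ^ card G * b {}" using t by simp
  ultimately have "(1 - t) * ((1 - t) ^ card G * a {}) + t * 0 \<le> (1 - t) * ?D a + t * ?D b"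
    using t by (intro add_mono mult_left_mono) auto
  also have "\<dots> = (\<Sum>F\<in>Pow (insert j G). (- t) ^ card F * a F)"
    unfolding split[OF order_refl] by (simp add: b_def algebra_simps sum_subtractf)
  finally show ?case using insert.hyps by (simp add: mult.assoc)
qed simp

lemma ordered_comp_scaled:
  fixes X :: "nat \<Rightarrow> 'a::complex_inner \<Rightarrow> 'a"
  assumes "finite F" "\<And>i. i \<in> F \<Longrightarrow> bounded_clinear (X i)"
    and "\<And>i x. i \<in> F \<Longrightarrow> Y i x = s i *\<^sub>R X i x"
  shows "ordered_comp Y F x = (\<Prod>i\<in>F. s i) *\<^sub>R ordered_comp X F x"
proof -
  have "foldr (\<circ>) (map Y xs) id x = (\<Prod>i\<leftarrow>xs. s i) *\<^sub>R foldr (\<circ>) (map X xs) id x"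
    if "set xs \<subseteq> F" for xs
    using that assms by (induction xs) (auto simp: bounded_clinearD)
  from this[of "sorted_list_of_set F"] show ?thesis
    using assms(1) by (simp add: ordered_comp_def prod.distinct_set_conv_list[symmetric])
qed

lemma coercive_form_cinner: "coercive_form (cinner :: 'a::complex_inner \<Rightarrow> _)"
proof -
  interpret bounded_sesquilinear "cinner :: 'a \<Rightarrow> _" by (rule sesquilinear_cinner)
  show ?thesis
  proof
    show "cinner y x = cnj (cinner x y)" for x y :: 'a by (rule cinner_commute)
    show "\<exists>e>0. \<forall>x::'a. e * (norm x)\<^sup>2 \<le> Re (cinner x x)"
      by (rule exI[of _ 1]) (simp add: cinner_self)
  qed
qed

lemma Re_brehmer_form:
  "Re (brehmer_form X G x x) = (\<Sum>F\<in>Pow G. (-1) ^ card F * (norm (ordered_comp X F x))\<^sup>2)"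
proof -
  have "Re ((-1) ^ card F * cinner (ordered_comp X F x) (ordered_comp X F x))
      = (-1) ^ card F * (norm (ordered_comp X F x))\<^sup>2" for F
    by (cases "even (card F)") (simp_all add: cinner_self)
  then show ?thesis by (simp add: brehmer_form_def)
qed

lemma commuting_family_scaled:
  assumes "commuting_family X F"
  shows "commuting_family (\<lambda>i x. s *\<^sub>R X i x) F"
proof -
  have X: "finite F" "bounded_clinear (X i)" "X i (X j x) = X j (X i x)" if "i \<in> F" "j \<in> F" for i j x
    using assms that unfolding commuting_family_def by (blast, blast, metis comp_apply)
  have "bounded_clinear (\<lambda>x. s *\<^sub>R X i x)" if "i \<in> F" for i
    using bounded_clinear_scaleC[OF X(2)[OF that that], of "complex_of_real s"]
    by (simp add: scaleC_of_real)
  moreover have "(\<lambda>x. s *\<^sub>R X i x) \<circ> (\<lambda>x. s *\<^sub>R X j x) = (\<lambda>x. s *\<^sub>R X j x) \<circ> (\<lambda>x. s *\<^sub>R X i x)"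
    if "i \<in> F" "j \<in> F" for i j
  proof
    show "((\<lambda>x. s *\<^sub>R X i x) \<circ> (\<lambda>x. s *\<^sub>R X j x)) x = ((\<lambda>x. s *\<^sub>R X j x) \<circ> (\<lambda>x. s *\<^sub>R X i x)) x" for x
      using X(3)[OF that, of x]
      by (simp add: bounded_clinearD[OF X(2)[OF that]] bounded_clinearD[OF X(2)[OF that(2,1)]])
  qed
  ultimately show ?thesis
    using assms by (simp add: commuting_family_def)
qed

text \<open>
  Positivity alone does not make the Brehmer forms inner products, but scaling by \<open>s < 1\<close> leaves at
  least the fraction \<open>(1 - s\<^sup>2) ^ card G\<close> of the original inner product.
\<close>

lemma coercive_brehmer_form:
  fixes X :: "nat \<Rightarrow> 'a::complex_inner \<Rightarrow> 'a"
  assumes cf: "commuting_family X G" and s: "0 < s" "s < 1"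
    and pos: "\<And>H x. H \<subseteq> G \<Longrightarrow> 0 \<le> (\<Sum>F\<in>Pow H. (-1) ^ card F * (norm (ordered_comp X F x))\<^sup>2)"
  shows "coercive_form (brehmer_form (\<lambda>i x. s *\<^sub>R X i x) G)"
proof -
  let ?Y = "\<lambda>i x. s *\<^sub>R X i x"
  have G: "finite G" using cf by (simp add: commuting_family_def)
  have lower: "(1 - s\<^sup>2) ^ card H * (norm x)\<^sup>2 \<le> Re (brehmer_form ?Y H x x)" if H: "H \<subseteq> G" for H x
  proof -
    have fin: "finite H" using H G by (rule finite_subset)
    have "(1 - s\<^sup>2) ^ card H * (norm (ordered_comp X {} x))\<^sup>2
        \<le> (\<Sum>F\<in>Pow H. (- (s\<^sup>2)) ^ card F * (norm (ordered_comp X F x))\<^sup>2)"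
      by (rule alternating_sum_scaled[OF _ _ fin]) (use s pos H in \<open>auto simp: power_le_one\<close>)
    also have "\<dots> = (\<Sum>F\<in>Pow H. (-1) ^ card F * (norm (ordered_comp ?Y F x))\<^sup>2)"
    proof (rule sum.cong)
      fix F assume F: "F \<in> Pow H"
      have "finite F" using F fin by (auto intro: finite_subset)
      moreover have "bounded_clinear (X i)" if "i \<in> F" for i
        using cf F H that unfolding commuting_family_def by blast
      ultimately have "ordered_comp ?Y F x = (\<Prod>i\<in>F. s) *\<^sub>R ordered_comp X F x"
        by (rule ordered_comp_scaled[where s = "\<lambda>_. s" and X = X]) simp_all
      then show "(- (s\<^sup>2)) ^ card F * (norm (ordered_comp X F x))\<^sup>2
          = (-1) ^ card F * (norm (ordered_comp ?Y F x))\<^sup>2"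
        using s by (simp add: power_mult_distrib power_minus[of "s\<^sup>2"] flip: power_mult)
          (simp add: mult.commute)
    qed simp
    finally show ?thesis by (simp add: Re_brehmer_form)
  qed
  have s2: "s\<^sup>2 < 1" using s by (simp add: power_less_one_iff)
  show ?thesis
    using G cf lower
  proof (induction G)
    case empty
    have "brehmer_form ?Y {} = cinner" by (simp add: brehmer_form_def fun_eq_iff)
    then show ?case by (simp add: coercive_form_cinner)
  next
    case (insert j G)
    have ins: "brehmer_form ?Y (insert j G) = defect (brehmer_form ?Y G) (?Y j)"
      by (rule brehmer_form_insert[OF commuting_family_scaled[OF insert.prems(1)] insert.hyps(2)])
    have "coercive_form (brehmer_form ?Y G)"
    proof (rule insert.IH)
      show "commuting_family X G" by (rule commuting_family_subset[OF insert.prems(1)]) auto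
      show "(1 - s\<^sup>2) ^ card H * (norm x)\<^sup>2 \<le> Re (brehmer_form ?Y H x x)" if "H \<subseteq> G" for H x
        by (rule insert.prems(2)) (use that in auto)
    qed
    then show ?case
      unfolding ins
    proof (rule coercive_form_defect)
      have "bounded_clinear (X j)" using insert.prems(1) by (simp add: commuting_family_def)
      then show "bounded_clinear (?Y j)"
        using bounded_clinear_scaleC[of "X j" "complex_of_real s"] by (simp add: scaleC_of_real)
      show "(1 - s\<^sup>2) ^ card (insert j G) > 0" using s2 by simp
      show "(1 - s\<^sup>2) ^ card (insert j G) * (norm x)\<^sup>2
          \<le> Re (brehmer_form ?Y G x x) - Re (brehmer_form ?Y G (?Y j x) (?Y j x))" for x
        using insert.prems(2)[OF order_refl, of x] unfolding ins by (simp add: defect_def)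
    qed
  qed
qed

text \<open>
  With \<open>S = I - {r, q}\<close>, induction on \<open>F \<subseteq> S\<close> moves the indices of \<open>F\<close> from the form to the tuple. It
  starts with the pair \<open>r, q\<close> and the form of \<open>S\<close>, whose two defects are the Brehmer forms of
  \<open>S \<union> {r}\<close> and \<open>S \<union> {q}\<close>; no form of a set containing both \<open>r\<close> and \<open>q\<close> is ever formed. It ends with
  the original inner product, the form of the empty set.
\<close>

lemma von_neumann_scaled:
  fixes X :: "nat \<Rightarrow> 'a::chilbert_space \<Rightarrow> 'a"
  assumes cf: "commuting_family X I" and rq: "r \<in> I" "q \<in> I" "r \<noteq> q" and s: "0 < s" "s < 1"
    and pos: "\<And>H x. H \<subseteq> I \<Longrightarrow> r \<notin> H \<or> q \<notin> H \<Longrightarrow>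
      0 \<le> (\<Sum>F\<in>Pow H. (-1) ^ card F * (norm (ordered_comp X F x))\<^sup>2)"
  shows "von_neumann cinner (\<lambda>i x. s *\<^sub>R X i x) I"
proof -
  let ?Y = "\<lambda>i x. s *\<^sub>R X i x"
  let ?S = "I - {r, q}"
  have cfY: "commuting_family ?Y I" by (rule commuting_family_scaled[OF cf])
  have coercive: "coercive_form (brehmer_form ?Y G)" if "G \<subseteq> I" "r \<notin> G \<or> q \<notin> G" for G
  proof (rule coercive_brehmer_form[OF commuting_family_subset[OF cf that(1)] s])
    show "0 \<le> (\<Sum>F\<in>Pow H. (-1) ^ card F * (norm (ordered_comp X F x))\<^sup>2)" if "H \<subseteq> G" for H x
      by (rule pos) (use that \<open>G \<subseteq> I\<close> \<open>r \<notin> G \<or> q \<notin> G\<close> in auto)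
  qed
  have ins: "brehmer_form ?Y (insert j G) = defect (brehmer_form ?Y G) (?Y j)"
    if "insert j G \<subseteq> I" "j \<notin> G" for j G
    by (rule brehmer_form_insert[OF commuting_family_subset[OF cfY that(1)] that(2)])
  have "von_neumann (brehmer_form ?Y (?S - F)) ?Y (F \<union> {r, q})" if "finite F" "F \<subseteq> ?S" for F
    using that
  proof (induction F)
    case empty
    have "von_neumann (brehmer_form ?Y ?S) ?Y {r, q}"
    proof (rule von_neumann_pair)
      show "coercive_form (brehmer_form ?Y ?S)" by (rule coercive) auto
      have "coercive_form (brehmer_form ?Y (insert r ?S))" by (rule coercive) (use rq in auto)
      then show "coercive_form (defect (brehmer_form ?Y ?S) (?Y r))"
        by (subst (asm) ins) (use rq in auto)
      have "coercive_form (brehmer_form ?Y (insert q ?S))" by (rule coercive) (use rq in auto)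
      then show "coercive_form (defect (brehmer_form ?Y ?S) (?Y q))"
        by (subst (asm) ins) (use rq in auto)
      show "commuting_family ?Y {r, q}" by (rule commuting_family_subset[OF cfY]) (use rq in auto)
    qed (rule rq)
    then show ?case by simp
  next
    case (insert j F)
    let ?Q = "brehmer_form ?Y (?S - insert j F)"
    have "?S - F = insert j (?S - insert j F)" using insert.prems insert.hyps by auto
    then have eq: "brehmer_form ?Y (?S - F) = defect ?Q (?Y j)"
      using ins[of j "?S - insert j F"] insert.prems by auto
    have "von_neumann ?Q ?Y (insert j (F \<union> {r, q}))"
    proof (rule von_neumann_insert)
      show "coercive_form ?Q" by (rule coercive) auto
      have "coercive_form (brehmer_form ?Y (?S - F))" by (rule coercive) auto
      then show "coercive_form (defect ?Q (?Y j))" by (simp only: eq)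
      show "commuting_family ?Y (insert j (F \<union> {r, q}))"
        by (rule commuting_family_subset[OF cfY]) (use insert.prems rq in auto)
      show "j \<notin> F \<union> {r, q}" using insert.prems insert.hyps by auto
      show "von_neumann (defect ?Q (?Y j)) ?Y (F \<union> {r, q})"
        using insert.IH insert.prems by (simp only: eq) auto
    qed
    then show ?case by (simp add: insert_commute)
  qed
  from this[of ?S] have "von_neumann (brehmer_form ?Y (?S - ?S)) ?Y (?S \<union> {r, q})"
    using cf by (simp add: commuting_family_def)
  moreover have "brehmer_form ?Y (?S - ?S) = cinner" by (simp add: brehmer_form_def fun_eq_iff)
  moreover have "?S \<union> {r, q} = I" using rq by auto
  ultimately show ?thesis by simp
qed

section \<open>Passing to the limit and to adjoints\<close>

lemma poly_eval_eq:
  assumes "p \<in> polys n"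
  shows "poly_eval p z = (\<Sum>\<alpha>\<in>Poly_Mapping.keys p.
    Poly_Mapping.lookup p \<alpha> * (\<Prod>i\<in>{1..n}. z i ^ Poly_Mapping.lookup \<alpha> i))"
  unfolding poly_eval_def
proof (rule sum.cong)
  fix \<alpha> assume "\<alpha> \<in> Poly_Mapping.keys p"
  then have "Poly_Mapping.keys \<alpha> \<subseteq> {1..n}" using assms by (simp add: polys_def)
  then have "(\<Prod>i\<in>Poly_Mapping.keys \<alpha>. z i ^ Poly_Mapping.lookup \<alpha> i)
      = (\<Prod>i\<in>{1..n}. z i ^ Poly_Mapping.lookup \<alpha> i)"
    by (intro prod.mono_neutral_left) (auto simp: in_keys_iff)
  then show "Poly_Mapping.lookup p \<alpha> * (\<Prod>i\<in>Poly_Mapping.keys \<alpha>. z i ^ Poly_Mapping.lookup \<alpha> i)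
      = Poly_Mapping.lookup p \<alpha> * (\<Prod>i\<in>{1..n}. z i ^ Poly_Mapping.lookup \<alpha> i)" by simp
qed simp

lemma sup_poly_eval_nonneg:
  assumes p: "p \<in> polys n"
  shows "0 \<le> (SUP z\<in>polydisc n. cmod (poly_eval p z))"
proof -
  obtain z where "z \<in> polydisc n" using polydisc_nonempty by blast
  from cSUP_upper[OF this bdd_above_poly_eval[OF p]] show ?thesis
    by (rule order_trans[OF norm_ge_zero])
qed

text \<open>
  The von Neumann inequality is proved with the supremum over the torus, whose points are limits of
  their radial contractions in the open polydisc.
\<close>

lemma poly_eval_torus_le:
  assumes p: "p \<in> polys n" and z: "\<And>i. i \<in> {1..n} \<Longrightarrow> cmod (z i) = 1"
  shows "cmod (poly_eval p z) \<le> (SUP z\<in>polydisc n. cmod (poly_eval p z))"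
proof (rule tendsto_upperbound)
  let ?w = "\<lambda>t i. if i \<in> {1..n} then complex_of_real t * z i else undefined"
  show "((\<lambda>t. cmod (\<Sum>\<alpha>\<in>Poly_Mapping.keys p. Poly_Mapping.lookup p \<alpha> *
      (\<Prod>i\<in>{1..n}. (complex_of_real t * z i) ^ Poly_Mapping.lookup \<alpha> i))) \<longlongrightarrow> cmod (poly_eval p z)) (at_left 1)"
    unfolding poly_eval_eq[OF p] by (auto intro!: tendsto_eq_intros)
  have "cmod (\<Sum>\<alpha>\<in>Poly_Mapping.keys p. Poly_Mapping.lookup p \<alpha> *
      (\<Prod>i\<in>{1..n}. (complex_of_real t * z i) ^ Poly_Mapping.lookup \<alpha> i))
      \<le> (SUP z\<in>polydisc n. cmod (poly_eval p z))" if t: "t \<in> {0<..<1}" for t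
  proof -
    have "?w t \<in> polydisc n" using t z by (auto simp: polydisc_def norm_mult)
    then have "cmod (poly_eval p (?w t)) \<le> (SUP z\<in>polydisc n. cmod (poly_eval p z))"
      by (rule cSUP_upper[OF _ bdd_above_poly_eval[OF p]])
    then show ?thesis by (simp add: poly_eval_eq[OF p])
  qed
  then show "\<forall>\<^sub>F t in at_left 1. cmod (\<Sum>\<alpha>\<in>Poly_Mapping.keys p. Poly_Mapping.lookup p \<alpha> *
      (\<Prod>i\<in>{1..n}. (complex_of_real t * z i) ^ Poly_Mapping.lookup \<alpha> i))
      \<le> (SUP z\<in>polydisc n. cmod (poly_eval p z))"
    using eventually_at_left_real[of 0 "1::real"] by (auto elim: eventually_mono)
qed simp

text \<open>
  The operator of a monomial multiplies over the variables that occur in it, whereas \<^const>\<open>monomial_op\<close>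
  multiplies over a fixed index set; the extra factors are powers with exponent zero.
\<close>

lemma ordered_comp_neutral:
  assumes "finite F" "G \<subseteq> F" "\<And>i. i \<in> F - G \<Longrightarrow> T i = id"
  shows "ordered_comp T F = ordered_comp T G"
proof -
  have G: "finite G" using assms(1,2) by (rule rev_finite_subset)
  have "ordered_comp T (D \<union> G) = ordered_comp T G" if "finite D" "D \<subseteq> F - G" for D
    using that
  proof (induction D)
    case (insert j D)
    have j: "T j = id" using insert.prems by (intro assms(3)) auto
    have "ordered_comp T (insert j (D \<union> G)) = T j \<circ> ordered_comp T (D \<union> G)"
      by (rule ordered_comp_insert) (use insert.prems insert.hyps G in \<open>auto simp: j\<close>)
    then show ?case using insert by (simp add: j)
  qed simp
  from this[of "F - G"] show ?thesis using assms(1,2) by (simp add: Un_absorb2)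
qed

lemma cinner_funpow:
  fixes A B :: "'a::complex_inner \<Rightarrow> 'a"
  assumes "\<And>x y. cinner (A x) y = cinner x (B y)"
  shows "cinner ((A ^^ k) x) y = cinner x ((B ^^ k) y)"
proof (induction k arbitrary: y)
  case (Suc k)
  have "cinner ((A ^^ Suc k) x) y = cinner ((A ^^ k) x) (B y)" by (simp add: assms)
  also have "\<dots> = cinner x ((B ^^ Suc k) y)" by (simp only: Suc funpow_Suc_right o_apply)
  finally show ?case .
qed simp

lemma poly_op_eq:
  assumes "p \<in> polys n"
  shows "poly_op p T x = (\<Sum>\<alpha>\<in>Poly_Mapping.keys p. Poly_Mapping.lookup p \<alpha> *\<^sub>C monomial_op T {1..n} \<alpha> x)"
  unfolding poly_op_def monomial_op_def
proof (rule sum.cong)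
  fix \<alpha> assume "\<alpha> \<in> Poly_Mapping.keys p"
  then have "Poly_Mapping.keys \<alpha> \<subseteq> {1..n}" using assms by (simp add: polys_def)
  then have "ordered_comp (\<lambda>i. T i ^^ Poly_Mapping.lookup \<alpha> i) {1..n}
      = ordered_comp (\<lambda>i. T i ^^ Poly_Mapping.lookup \<alpha> i) (Poly_Mapping.keys \<alpha>)"
    by (intro ordered_comp_neutral) (auto simp: in_keys_iff fun_eq_iff)
  then show "Poly_Mapping.lookup p \<alpha> *\<^sub>C ordered_comp (\<lambda>i. T i ^^ Poly_Mapping.lookup \<alpha> i) (Poly_Mapping.keys \<alpha>) x
      = Poly_Mapping.lookup p \<alpha> *\<^sub>C ordered_comp (\<lambda>i. T i ^^ Poly_Mapping.lookup \<alpha> i) {1..n} x"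
    by simp
qed simp

lemma adjoint_monomial_op:
  assumes T: "T \<in> commuting_contractions n"
  shows "cinner (monomial_op T {1..n} \<alpha> x) y = cinner x (monomial_op (\<lambda>i. cadjoint (T i)) {1..n} \<alpha> y)"
  unfolding monomial_op_def
proof (rule cinner_ordered_comp)
  show "cinner ((T i ^^ Poly_Mapping.lookup \<alpha> i) x) y
      = cinner x ((cadjoint (T i) ^^ Poly_Mapping.lookup \<alpha> i) y)" if "i \<in> {1..n}" for i x y
    by (intro cinner_funpow cadjoint) (use T that in \<open>auto simp: commuting_contractions_def\<close>)
  show "T i ^^ k \<circ> T j ^^ l = T j ^^ l \<circ> T i ^^ k" if "i \<in> {1..n}" "j \<in> {1..n}" for i j k l
    by (rule funpow_commute) (use T that in \<open>unfold commuting_contractions_def, blast\<close>)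
  show "cadjoint (T i) ^^ k \<circ> cadjoint (T j) ^^ l = cadjoint (T j) ^^ l \<circ> cadjoint (T i) ^^ k"
    if "i \<in> {1..n}" "j \<in> {1..n}" for i j k l
    by (rule funpow_commute)
      (use adjoint_family[OF T] that in \<open>unfold commuting_family_def, blast\<close>)
qed simp

lemma monomial_op_scaled:
  assumes cf: "commuting_family X F"
  shows "monomial_op (\<lambda>i x. s *\<^sub>R X i x) F \<alpha> h
    = s ^ (\<Sum>i\<in>F. Poly_Mapping.lookup \<alpha> i) *\<^sub>R monomial_op X F \<alpha> h"
proof -
  have X: "bounded_clinear (X i)" if "i \<in> F" for i using cf that by (simp add: commuting_family_def)
  have "((\<lambda>x. s *\<^sub>R X i x) ^^ k) x = s ^ k *\<^sub>R (X i ^^ k) x" if "i \<in> F" for i k x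
    by (induction k) (simp_all add: bounded_clinearD[OF X[OF that]])
  then have "monomial_op (\<lambda>i x. s *\<^sub>R X i x) F \<alpha> h
      = (\<Prod>i\<in>F. s ^ Poly_Mapping.lookup \<alpha> i) *\<^sub>R monomial_op X F \<alpha> h"
    unfolding monomial_op_def
    by (intro ordered_comp_scaled bounded_clinear_funpow X) (use cf in \<open>simp_all add: commuting_family_def\<close>)
  then show ?thesis by (simp add: power_sum)
qed

text \<open>
  The bound holds for the scaled adjoints with every \<open>s < 1\<close>, and the sum is a polynomial in \<open>s\<close> with
  vector coefficients, so that \<open>s\<close> may tend to \<open>1\<close>. Conjugating the coefficients of \<open>p\<close> amounts to
  evaluating \<open>p\<close> at the conjugate point of the torus.
\<close>

lemma adjoint_poly_bound:
  fixes T :: "nat \<Rightarrow> 'a::chilbert_space \<Rightarrow> 'a"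
  assumes rq: "1 \<le> r" "r < q" "q \<le> n" and T: "T \<in> brehmer_rq n r q" and p: "p \<in> polys n"
  shows "norm (\<Sum>\<alpha>\<in>Poly_Mapping.keys p. cnj (Poly_Mapping.lookup p \<alpha>) *\<^sub>C
      monomial_op (\<lambda>i. cadjoint (T i)) {1..n} \<alpha> h)
    \<le> (SUP z\<in>polydisc n. cmod (poly_eval p z)) * norm h"
proof (rule tendsto_upperbound)
  let ?X = "\<lambda>i. cadjoint (T i)"
  let ?C = "SUP z\<in>polydisc n. cmod (poly_eval p z)"
  let ?K = "Poly_Mapping.keys p"
  let ?V = "\<lambda>s. \<Sum>\<alpha>\<in>?K. cnj (Poly_Mapping.lookup p \<alpha>) *\<^sub>C
      s ^ (\<Sum>i\<in>{1..n}. Poly_Mapping.lookup \<alpha> i) *\<^sub>R monomial_op ?X {1..n} \<alpha> h"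
  have T': "T \<in> commuting_contractions n" "delete_entry r T \<in> brehmer (n - 1)"
    "delete_entry q T \<in> brehmer (n - 1)"
    using T by (auto simp: brehmer_rq_def)
  have cf: "commuting_family ?X {1..n}" by (rule adjoint_family[OF T'(1)])
  have C0: "0 \<le> ?C" by (rule sup_poly_eval_nonneg[OF p])
  have swap: "c *\<^sub>C r *\<^sub>R x = r *\<^sub>R c *\<^sub>C x" for c r and x :: 'a
    by (simp add: scaleC_scaleC mult.commute flip: scaleC_of_real)
  have "norm (?V s) \<le> ?C * norm h" if s: "s \<in> {0<..<1}" for s
  proof -
    have vN: "von_neumann cinner (\<lambda>i x. s *\<^sub>R ?X i x) {1..n}"
    proof (rule von_neumann_scaled[OF cf, of r q])
      show "0 \<le> (\<Sum>F\<in>Pow H. (-1) ^ card F * (norm (ordered_comp ?X F x))\<^sup>2)"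
        if "H \<subseteq> {1..n}" "r \<notin> H \<or> q \<notin> H" for H x
        using that(2)
      proof
        assume "r \<notin> H"
        then show ?thesis
          by (intro brehmer_delete_entry[OF T'(1,2)]) (use rq that(1) in auto)
      next
        assume "q \<notin> H"
        then show ?thesis
          by (intro brehmer_delete_entry[OF T'(1,3)]) (use rq that(1) in auto)
      qed
    qed (use rq s in auto)
    have bd: "cmod (\<Sum>\<alpha>\<in>?K. cnj (Poly_Mapping.lookup p \<alpha>) * (\<Prod>i\<in>{1..n}. z i ^ Poly_Mapping.lookup \<alpha> i)) \<le> ?C"
      if z: "\<forall>i\<in>{1..n}. cmod (z i) = 1" for z
    proof -
      have "(\<Sum>\<alpha>\<in>?K. cnj (Poly_Mapping.lookup p \<alpha>) * (\<Prod>i\<in>{1..n}. z i ^ Poly_Mapping.lookup \<alpha> i))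
          = cnj (poly_eval p (\<lambda>i. cnj (z i)))"
        by (simp add: poly_eval_eq[OF p])
      then show ?thesis using poly_eval_torus_le[OF p, of "\<lambda>i. cnj (z i)"] z by simp
    qed
    have "(norm (?V s))\<^sup>2 \<le> ?C\<^sup>2 * (norm h)\<^sup>2"
      using von_neumannD[OF vN finite_keys bd, where h = h]
      unfolding monomial_op_scaled[OF cf] by (simp add: cinner_self)
    then have "(norm (?V s))\<^sup>2 \<le> (?C * norm h)\<^sup>2" by (simp add: power_mult_distrib)
    then show ?thesis by (rule power2_le_imp_le) (simp add: C0)
  qed
  then show "\<forall>\<^sub>F s in at_left 1. norm (?V s) \<le> ?C * norm h"
    using eventually_at_left_real[of 0 "1::real"] by (auto elim: eventually_mono)
  show "((\<lambda>s. norm (?V s)) \<longlongrightarrow> norm (\<Sum>\<alpha>\<in>?K. cnj (Poly_Mapping.lookup p \<alpha>) *\<^sub>C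
      monomial_op ?X {1..n} \<alpha> h)) (at_left 1)"
    unfolding swap by (auto intro!: tendsto_eq_intros)
qed simp

theorem theorem3p11:
  fixes T :: "nat \<Rightarrow> 'a::chilbert_space \<Rightarrow> 'a" and n r q :: nat and p :: cpoly
  assumes "n \<ge> 3"
    and "1 \<le> r" and "r < q" and "q \<le> n"
    and "T \<in> brehmer_rq n r q"
    and "p \<in> polys n"
  shows "onorm (poly_op p T) \<le> (SUP z\<in>polydisc n. cmod (poly_eval p z))"
proof (rule onorm_bound[OF sup_poly_eval_nonneg[OF assms(6)]])
  fix x
  let ?C = "SUP z\<in>polydisc n. cmod (poly_eval p z)"
  interpret bounded_sesquilinear "cinner :: 'a \<Rightarrow> _" by (rule sesquilinear_cinner)
  define S where "S y = (\<Sum>\<alpha>\<in>Poly_Mapping.keys p. cnj (Poly_Mapping.lookup p \<alpha>) *\<^sub>C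
      monomial_op (\<lambda>i. cadjoint (T i)) {1..n} \<alpha> y)" for y
  have T: "T \<in> commuting_contractions n" using assms(5) by (simp add: brehmer_rq_def)
  have adj: "cinner (poly_op p T x) y = cinner x (S y)" for y
    unfolding poly_op_eq[OF assms(6)] S_def sum_left sum_right
    by (simp only: scale_left scale_right complex_cnj_cnj adjoint_monomial_op[OF T])
  let ?y = "poly_op p T x"
  show "norm ?y \<le> ?C * norm x"
  proof (cases "?y = 0")
    case True
    then show ?thesis using sup_poly_eval_nonneg[OF assms(6)] by simp
  next
    case False
    have "(norm ?y)\<^sup>2 = cmod (cinner x (S ?y))"
      by (simp add: cinner_self flip: adj of_real_power)
    also have "\<dots> \<le> norm x * norm (S ?y)" by (rule norm_cinner_le)
    also have "\<dots> \<le> norm x * (?C * norm ?y)"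
      unfolding S_def by (intro mult_left_mono adjoint_poly_bound[OF assms(2-6)]) simp
    finally show ?thesis using False by (simp add: power2_eq_square mult_ac)
  qed
qed

end
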